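(* Let $\alpha>0$ be a real number and let $\mathcal{B}\subseteq\mathbb{N}$ be a set satisfying the $c$-condition (see context) such that $\mathcal{B}(x)\gg x^{\alpha}$, i.e. there is a constant $C>0$ with $\mathcal{B}(x)\ge C x^{\alpha}$ for all sufficiently large $x$. Then $$\mathcal{S}(x)=\#\{n\le x:\ n=p+b,\ p\in\mathcal{P},\ b\in\mathcal{B}\}\gg \frac{x}{\log\log\log x},$$ i.e. there is a constant $C'>0$ (depending on $\mathcal{B}$ and $\alpha$) such that $\mathcal{S}(x)\ge C' x/\log\log\log x$ for all sufficiently large $x$.
   Context: $\mathbb{N}$ denotes the set of positive integers and $\mathcal{P}$ the set of primes. For a set $\mathcal{A}\subseteq\mathbb{N}$, $\mathcal{A}(x)=|\mathcal{A}\cap[1,x]|$. A set $\mathcal{B}\subseteq\mathbb{N}$ is said to satisfy the $c$-condition if there is a constant $0<c<1$ such that $\mathcal{B}(cx)\gg\mathcal{B}(x)$, i.e. there is a constant $K>0$ with $\mathcal{B}(cx)\ge K\,\mathcal{B}(x)$ for all sufficiently large $x$. $\mathcal{S}(x)$ counts the distinct integers $n\le x$ representable as $p+b$ with $p$ prime and $b\in\mathcal{B}$. *)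

theory Defs
  imports Complex_Main "HOL-Computational_Algebra.Primes"
begin

definition counting :: "nat set \<Rightarrow> real \<Rightarrow> nat" where
  "counting A x = card {n \<in> A. 1 \<le> n \<and> real n \<le> x}"

definition c_condition :: "nat set \<Rightarrow> bool" where
  "c_condition B \<longleftrightarrow>
     (\<exists>c::real. 0 < c \<and> c < 1 \<and>
       (\<exists>K::real. K > 0 \<and>
         (\<forall>\<^sub>F x in at_top. real (counting B (c * x)) \<ge> K * real (counting B x))))"

definition prime_plus :: "nat set \<Rightarrow> nat set" where
  "prime_plus B = {n. \<exists>p b. prime p \<and> b \<in> B \<and> n = p + b}"

end

theory Submission
  imports Defs "HOL-Computational_Algebra.Squarefree" "HOL-Number_Theory.Prime_Powers"
    "HOL-Number_Theory.Cong" "HOL-Real_Asymp.Real_Asymp" "HOL-Analysis.Convex"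
begin

text \<open>Only the very small elements of \<open>B\<close> are used, namely those up to \<open>y = (ln x)\<^sup>E\<close> with \<open>E = 3 / \<alpha>\<close>;
  there are at least \<open>(ln x)\<^sup>2\<close> of them. By Cauchy--Schwarz, the number of sums \<open>p + b\<close> with \<open>p \<le> x / 2\<close>
  is bounded below in terms of Chebyshev's lower bound for \<open>\<pi>(x)\<close> and of upper bounds for the number of
  \<open>n \<le> x\<close> with \<open>n\<close> and \<open>n + k\<close> both prime, where \<open>0 < k \<le> y\<close>. Selberg's sieve bounds the latter by a constant
  times \<open>x / (ln x)\<^sup>2 \<cdot> \<Prod> (1 + 1 / p)\<close>, the product over the primes dividing \<open>k\<close>. That product is
  \<open>O(ln (ln k)) = O(ln (ln (ln x)))\<close>, because \<open>k\<close> is at most a power of \<open>ln x\<close>.\<close>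

subsection \<open>Selberg weights\<close>

text \<open>The sieve bound is used through its worst case over all differences \<open>k\<close>,
  without averaging over pairs. The product over the primes dividing \<open>k\<close> therefore
  enters at its maximum, and this maximum is the entire loss against the order \<open>x\<close>;
  keeping the elements of \<open>B\<close> tiny is what keeps it small. The opposite constraint is
  the diagonal \<open>b = b'\<close> in the second moment: \<open>B\<close> must supply enough
  elements that these pairs do not dominate. With only the trivial bound \<open>x\<close> for the
  number of primes, \<open>(ln x)^2\<close> elements suffice. The numerator 3 of \<open>E\<close>,
  instead of 2, leaves a factor \<open>ln x\<close> to absorb the unknown constant in the growth of
  \<open>B\<close>. Since constants do not matter, the sieve level can be a very small power of
  \<open>x\<close>, which makes crude remainder bounds affordable. The dependence on
  \<open>k\<close> appears when the Selberg sum is bounded below: the square of a sum of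
  \<open>1 / n\<close> over odd squarefree \<open>n\<close> is compared with it prime by prime, and
  only primes dividing \<open>k\<close> need a correction.\<close>

lemma sum_minus_one_power_between:
  assumes "finite C" "E \<subseteq> C"
  shows "(\<Sum>A | E \<subseteq> A \<and> A \<subseteq> C. (-1::real) ^ card A) = (if E = C then (-1) ^ card E else 0)"
proof -
  have fE: "finite E" using assms finite_subset by blast
  \<comment> \<open>Moebius inversion on the Boolean lattice: with \<open>A = E \<union> T\<close>
    the sum over \<open>T\<close> factors into terms \<open>1 - 1\<close>, one for each element of
    \<open>C - E\<close>, and vanishes unless there are none.\<close>
  have "(\<Sum>A | E \<subseteq> A \<and> A \<subseteq> C. (-1::real) ^ card A) = (\<Sum>T\<in>Pow (C - E). (-1) ^ card E * (-1) ^ card T)"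
  proof (rule sum.reindex_bij_witness[of _ "\<lambda>T. E \<union> T" "\<lambda>A. A - E"])
    fix A assume A: "A \<in> {A. E \<subseteq> A \<and> A \<subseteq> C}"
    hence "finite A" using assms(1) finite_subset by blast
    hence "card A = card E + card (A - E)" using A fE
      by (metis Diff_disjoint Diff_partition card_Un_disjoint finite_Diff mem_Collect_eq)
    thus "(-1) ^ card E * (-1) ^ card (A - E) = (-1::real) ^ card A"
      by (simp add: power_add)
  qed (use assms in auto)
  also have "\<dots> = (-1) ^ card E * (\<Prod>p\<in>C - E. 1 - (1::real))"
    using prod_add[of "C - E" "\<lambda>_. -1::real" "\<lambda>_. 1"] assms(1)
    by (simp add: sum_distrib_left add: prod_uminus)
  also have "\<dots> = (if E = C then (-1) ^ card E else 0)"
    using assms by (cases "E = C") auto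
  finally show ?thesis .
qed

lemma prod_one_plus_Pow:
  fixes h :: "'a \<Rightarrow> real"
  assumes "finite A"
  shows "(\<Prod>p\<in>A. 1 + h p) = (\<Sum>X\<in>Pow A. \<Prod>p\<in>X. h p)"
  using prod_add[OF assms, of h "\<lambda>_. 1"] by (simp add: add.commute)

text \<open>Selberg's optimal weights, with squarefree numbers represented by their sets of prime factors, so that
  lcm and gcd become union and intersection. The bound on the weights is the one obtained by dropping all
  summation conditions, which suffices for a sieve level that is a small power of the sifting range.\<close>
lemma selberg_weights:
  fixes f :: "'a \<Rightarrow> real"
  assumes finD: "finite D" and fin: "\<And>A. A \<in> D \<Longrightarrow> finite A"
    and down: "\<And>A B. A \<in> D \<Longrightarrow> B \<subseteq> A \<Longrightarrow> B \<in> D" and empty: "{} \<in> D"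
    and f: "\<And>A p. A \<in> D \<Longrightarrow> p \<in> A \<Longrightarrow> f p > 1"
  defines "V \<equiv> (\<Sum>A\<in>D. \<Prod>p\<in>A. 1 / (f p - 1))"
  obtains w where "w {} = 1" "\<And>A. A \<in> D \<Longrightarrow> \<bar>w A\<bar> \<le> (\<Prod>p\<in>A. f p / (f p - 1))"
    "(\<Sum>A\<in>D. \<Sum>B\<in>D. w A * w B / (\<Prod>p\<in>A \<union> B. f p)) = 1 / V"
proof -
  define g where "g = (\<lambda>A. \<Prod>p\<in>A. 1 / (f p - 1))"
  define F where "F = (\<lambda>A. \<Prod>p\<in>A. f p)"
  define h where "h = (\<lambda>A. \<Prod>p\<in>A. f p - 1)"
  have gpos: "g A > 0" if "A \<in> D" for A
    unfolding g_def using f[OF that] by (intro prod_pos) auto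
  have Fpos: "F A > 0" if "A \<in> D" for A
    unfolding F_def using f[OF that] by (intro prod_pos) (auto intro: less_trans[OF zero_less_one])
  have V: "V = (\<Sum>A\<in>D. g A)" by (simp add: V_def g_def)
  have Vpos: "V > 0" unfolding V using finD empty gpos by (intro sum_pos) auto
  have gh: "h A * g A = 1" if "A \<in> D" for A
  proof -
    have "h A * g A = (\<Prod>p\<in>A. (f p - 1) * (1 / (f p - 1)))"
      unfolding h_def g_def by (rule prod.distrib[symmetric])
    also have "\<dots> = 1" using f[OF that] by (intro prod.neutral) force
    finally show ?thesis .
  qed
  \<comment> \<open>In the variables \<open>y\<close> the quadratic form becomes diagonal,
    \<open>h E\<close> times the square of \<open>y E\<close>, and \<open>w {} = 1\<close> becomes a
    linear constraint. The minimum makes \<open>h E * y E\<close> equal to plus or minus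
    \<open>1 / V\<close>; inverting the change of variables gives this \<open>w\<close>.\<close>
  define w where "w = (\<lambda>A. (-1) ^ card A * F A * (\<Sum>E | E \<in> D \<and> A \<subseteq> E. g E) / V)"
  define y where "y = (\<lambda>E. \<Sum>A | A \<in> D \<and> E \<subseteq> A. w A / F A)"
  have y: "y E = (-1) ^ card E * g E / V" if E: "E \<in> D" for E
  proof -
    have "y E = (\<Sum>A | A \<in> D \<and> E \<subseteq> A. \<Sum>C | C \<in> D \<and> A \<subseteq> C. (-1) ^ card A * g C / V)"
      unfolding y_def
    proof (intro sum.cong refl)
      fix A assume "A \<in> {A. A \<in> D \<and> E \<subseteq> A}"
      hence "F A \<noteq> 0" using Fpos[of A] by auto
      thus "w A / F A = (\<Sum>C | C \<in> D \<and> A \<subseteq> C. (-1) ^ card A * g C / V)"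
        by (simp add: w_def sum_distrib_left sum_divide_distrib)
    qed
    also have "\<dots> = (\<Sum>C\<in>D. \<Sum>A | A \<in> {A\<in>D. E \<subseteq> A} \<and> A \<subseteq> C. (-1) ^ card A * g C / V)"
      using finD by (intro sum.swap_restrict) auto
    also have "\<dots> = (\<Sum>C\<in>D. if C = E then (-1) ^ card E * g E / V else 0)"
    proof (intro sum.cong refl)
      fix C assume C: "C \<in> D"
      show "(\<Sum>A | A \<in> {A\<in>D. E \<subseteq> A} \<and> A \<subseteq> C. (-1) ^ card A * g C / V) =
            (if C = E then (-1) ^ card E * g E / V else 0)"
      proof (cases "E \<subseteq> C")
        case True
        have "{A. A \<in> {A\<in>D. E \<subseteq> A} \<and> A \<subseteq> C} = {A. E \<subseteq> A \<and> A \<subseteq> C}"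
          using down[OF C] by auto
        thus ?thesis
          using sum_minus_one_power_between[OF fin[OF C] True]
          by (auto simp flip: sum_distrib_right sum_divide_distrib)
      next
        case False
        hence "{A. A \<in> {A\<in>D. E \<subseteq> A} \<and> A \<subseteq> C} = {}" by auto
        thus ?thesis using False by (metis order_refl sum.empty)
      qed
    qed
    also have "\<dots> = (-1) ^ card E * g E / V" using finD E by simp
    finally show ?thesis .
  qed
  show ?thesis
  proof (rule that[of w])
    show "w {} = 1" using Vpos by (simp add: w_def F_def V)
  next
    fix A assume A: "A \<in> D"
    have "(\<Sum>E | E \<in> D \<and> A \<subseteq> E. g E) = (\<Sum>E | E \<in> D \<and> A \<subseteq> E. g A * g (E - A))"
    proof (intro sum.cong refl)
      fix E assume "E \<in> {E. E \<in> D \<and> A \<subseteq> E}"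
      thus "g E = g A * g (E - A)" unfolding g_def using fin
        by (metis (no_types, lifting) mem_Collect_eq mult.commute prod.subset_diff)
    qed
    \<comment> \<open>The sets \<open>E - A\<close> are distinct and again in \<open>D\<close> by
      downward closure, so the sum over them is at most the full sum \<open>V\<close>.\<close>
    also have "\<dots> = g A * (\<Sum>E\<in>(\<lambda>E. E - A) ` {E. E \<in> D \<and> A \<subseteq> E}. g E)"
      by (subst sum.reindex) (auto simp: inj_on_def sum_distrib_left)
    also have "\<dots> \<le> g A * V" unfolding V
      using down finD gpos A
      by (intro mult_left_mono sum_mono2) (auto intro: less_imp_le)
    finally have "(\<Sum>E | E \<in> D \<and> A \<subseteq> E. g E) / V \<le> g A"
      using Vpos by (simp add: divide_le_eq)
    moreover have "0 \<le> (\<Sum>E | E \<in> D \<and> A \<subseteq> E. g E) / V"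
      using Vpos gpos by (intro divide_nonneg_pos sum_nonneg) (auto intro: less_imp_le)
    moreover have "\<bar>w A\<bar> = F A * \<bar>(\<Sum>E | E \<in> D \<and> A \<subseteq> E. g E) / V\<bar>"
      using Fpos[OF A] by (simp add: w_def abs_mult power_abs)
    ultimately have "\<bar>w A\<bar> \<le> F A * g A"
      using Fpos[OF A] by (metis abs_of_nonneg less_imp_le mult_left_mono)
    thus "\<bar>w A\<bar> \<le> (\<Prod>p\<in>A. f p / (f p - 1))"
      by (simp add: F_def g_def flip: prod.distrib)
  next
    \<comment> \<open>The union couples \<open>A\<close> and \<open>B\<close>. It is traded for
      \<open>F (A \<inter> B)\<close>, which expands as a sum of \<open>h E\<close> over common
      subsets \<open>E\<close>; for fixed \<open>E\<close> the two sums then separate.\<close>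
    have "(\<Sum>A\<in>D. \<Sum>B\<in>D. w A * w B / F (A \<union> B)) =
          (\<Sum>A\<in>D. \<Sum>B\<in>D. \<Sum>E | E \<in> D \<and> E \<subseteq> A \<inter> B. h E * (w A / F A) * (w B / F B))"
    proof (intro sum.cong refl)
      fix A B assume A: "A \<in> D" and B: "B \<in> D"
      have "F (A \<inter> B) = (\<Sum>X\<in>Pow (A \<inter> B). h X)"
        using prod_one_plus_Pow[of "A \<inter> B" "\<lambda>p. f p - 1"] fin[OF A] by (simp add: F_def h_def)
      also have "Pow (A \<inter> B) = {E. E \<in> D \<and> E \<subseteq> A \<inter> B}" using down[OF A] by auto
      finally have *: "F (A \<inter> B) = (\<Sum>E | E \<in> D \<and> E \<subseteq> A \<inter> B. h E)" .
      have "F (A \<union> B) * F (A \<inter> B) = F A * F B"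
        unfolding F_def using prod.union_inter[OF fin[OF A] fin[OF B]] .
      moreover have "F (A \<inter> B) > 0" "F A > 0" "F B > 0" using down[OF A] A B Fpos by auto
      ultimately have **: "F (A \<union> B) = F A * F B / F (A \<inter> B)"
        by (simp add: eq_divide_eq)
      have "w A * w B / F (A \<union> B) = F (A \<inter> B) * (w A / F A) * (w B / F B)"
        unfolding ** by (simp add: mult_ac)
      thus "w A * w B / F (A \<union> B) = (\<Sum>E | E \<in> D \<and> E \<subseteq> A \<inter> B. h E * (w A / F A) * (w B / F B))"
        by (simp only: * sum_distrib_right)
    qed
    also have "\<dots> = (\<Sum>A\<in>D. \<Sum>E | E \<in> D \<and> E \<subseteq> A. \<Sum>B | B \<in> D \<and> E \<subseteq> B. h E * (w A / F A) * (w B / F B))"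
    proof (rule sum.cong[OF refl])
      fix A assume A: "A \<in> D"
      have "(\<Sum>B\<in>D. \<Sum>E | E \<in> D \<and> E \<subseteq> A \<inter> B. h E * (w A / F A) * (w B / F B)) =
            (\<Sum>B\<in>D. \<Sum>E | E \<in> {E\<in>D. E \<subseteq> A} \<and> E \<subseteq> B. h E * (w A / F A) * (w B / F B))"
        by (intro sum.cong) auto
      also have "\<dots> = (\<Sum>E\<in>{E\<in>D. E \<subseteq> A}. \<Sum>B | B \<in> D \<and> E \<subseteq> B. h E * (w A / F A) * (w B / F B))"
        using finD by (intro sum.swap_restrict) auto
      finally show "(\<Sum>B\<in>D. \<Sum>E | E \<in> D \<and> E \<subseteq> A \<inter> B. h E * (w A / F A) * (w B / F B)) =
        (\<Sum>E | E \<in> D \<and> E \<subseteq> A. \<Sum>B | B \<in> D \<and> E \<subseteq> B. h E * (w A / F A) * (w B / F B))" .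
    qed
    also have "\<dots> = (\<Sum>E\<in>D. \<Sum>A | A \<in> D \<and> E \<subseteq> A. \<Sum>B | B \<in> D \<and> E \<subseteq> B. h E * (w A / F A) * (w B / F B))"
      using finD by (intro sum.swap_restrict) auto
    also have "\<dots> = (\<Sum>E\<in>D. h E * (y E)\<^sup>2)"
      unfolding y_def power2_eq_square sum_product by (simp only: sum_distrib_left mult.assoc)
    also have "\<dots> = (\<Sum>E\<in>D. g E / V\<^sup>2)"
    proof (intro sum.cong refl)
      fix E assume E: "E \<in> D"
      have "h E * (y E)\<^sup>2 = (h E * g E) * g E / V\<^sup>2"
        by (simp add: y[OF E] power2_eq_square power_divide flip: power_mult_distrib)
      thus "h E * (y E)\<^sup>2 = g E / V\<^sup>2" by (simp add: gh[OF E])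
    qed
    also have "\<dots> = 1 / V" using Vpos by (simp add: V[symmetric] power2_eq_square flip: sum_divide_distrib)
    finally show "(\<Sum>A\<in>D. \<Sum>B\<in>D. w A * w B / (\<Prod>p\<in>A \<union> B. f p)) = 1 / V" by (simp add: F_def)
  qed
qed

subsection \<open>The sieve for prime pairs\<close>

lemma card_mod_eq_bound:
  assumes "r < (d::nat)"
  shows "\<bar>real (card {n\<in>{1..N}. n mod d = r}) - real N / real d\<bar> \<le> 1"
proof -
  let ?S = "{n\<in>{1..N}. n mod d = r}" and ?q = "N div d"
  have d: "d > 0" using assms by simp
  have "inj_on (\<lambda>n. n div d) ?S"
    by (intro inj_onI) (metis (mono_tags, lifting) mem_Collect_eq mult_div_mod_eq)
  moreover have "(\<lambda>n. n div d) ` ?S \<subseteq> {0..?q}" by (auto intro: div_le_mono)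
  ultimately have "card ?S \<le> card {0..?q}" by (metis card_inj_on_le finite_atLeastAtMost)
  hence upper: "real (card ?S) \<le> real ?q + 1" by simp
  \<comment> \<open>Counting starts at \<open>n = 1\<close>, so residue 0 is first met at
    \<open>d\<close>, not at 0; shifting the quotients by one keeps their number equal to
    \<open>N div d\<close> in both cases.\<close>
  define Q where "Q = (if r = 0 then {1..?q} else {0..<?q})"
  have lt: "q * d + r \<le> N" if "q < ?q" for q
  proof -
    have "q * d + r \<le> (q + 1) * d" using assms by (simp add: algebra_simps)
    also have "\<dots> \<le> ?q * d" using that by (intro mult_right_mono) auto
    also have "\<dots> \<le> N" by simp
    finally show ?thesis .
  qed
  have le: "q * d \<le> N" if "q \<le> ?q" for q
    using that by (metis div_times_less_eq_dividend le_trans mult_le_mono1)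
  have "(\<lambda>q. q * d + r) ` Q \<subseteq> ?S"
    using d assms lt le by (auto simp: Q_def split: if_splits)
  moreover have "inj_on (\<lambda>q. q * d + r) Q" using d by (intro inj_onI) auto
  ultimately have "card Q \<le> card ?S" by (intro card_inj_on_le) auto
  hence lower: "real ?q \<le> real (card ?S)" by (simp add: Q_def split: if_splits)
  have "real N = real d * real ?q + real (N mod d)"
    by (metis mult_div_mod_eq of_nat_add of_nat_mult)
  moreover have "real (N mod d) < real d" using d by simp
  ultimately have "real N / real d \<ge> real ?q" "real N / real d \<le> real ?q + 1"
    using d by (auto simp: field_simps)
  thus ?thesis using upper lower by linarith
qed

definition pair_roots :: "nat \<Rightarrow> nat \<Rightarrow> nat set" where
  "pair_roots k d = {r. r < d \<and> d dvd r * (r + k)}"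

text \<open>The number of residue classes modulo a prime \<open>p\<close> on which \<open>n (n + k)\<close> vanishes.\<close>
definition pair_density :: "nat \<Rightarrow> nat \<Rightarrow> nat" where
  "pair_density k p = (if p dvd k then 1 else 2)"

lemma finite_pair_roots [simp]: "finite (pair_roots k d)"
  by (rule finite_subset[of _ "{..<d}"]) (auto simp: pair_roots_def)

lemma dvd_mod_pair_iff: "d dvd (x mod d) * (x mod d + k) \<longleftrightarrow> d dvd x * (x + k)" for d :: nat
proof -
  have "(x mod d) * (x mod d + k) mod d = x * (x + k) mod d"
    by (metis mod_add_left_eq mod_mult_eq mod_mod_trivial)
  thus ?thesis by (simp only: dvd_eq_mod_eq_0)
qed

text \<open>Chinese remainder theorem: reduction modulo \<open>m\<close> and \<open>n\<close> is a
  bijection onto pairs of roots.\<close>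

lemma card_pair_roots_mult:
  assumes "coprime m n" "m > 0" "n > 0"
  shows "card (pair_roots k (m * n)) = card (pair_roots k m) * card (pair_roots k n)"
proof -
  have "bij_betw (\<lambda>x. (x mod m, x mod n)) (pair_roots k (m * n)) (pair_roots k m \<times> pair_roots k n)"
    unfolding bij_betw_def
  proof
    show "inj_on (\<lambda>x. (x mod m, x mod n)) (pair_roots k (m * n))"
    proof (intro inj_onI, clarify)
      fix x y assume xy: "x \<in> pair_roots k (m * n)" "y \<in> pair_roots k (m * n)"
        "x mod m = y mod m" "x mod n = y mod n"
      have ex: "\<exists>!z. z < m * n \<and> [z = x] (mod m) \<and> [z = x] (mod n)"
        by (rule binary_chinese_remainder_unique_nat) (use assms in simp_all)
      have "[y = x] (mod m)" "[y = x] (mod n)" using xy(3,4)[symmetric] unfolding Cong.cong_def by auto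
      hence "x < m * n \<and> [x = x] (mod m) \<and> [x = x] (mod n)"
        "y < m * n \<and> [y = x] (mod m) \<and> [y = x] (mod n)"
        using xy(1,2) by (simp_all add: pair_roots_def)
      from this[THEN the1_equality[OF ex]] show "x = y" by simp
    qed
  next
    show "(\<lambda>x. (x mod m, x mod n)) ` pair_roots k (m * n) = pair_roots k m \<times> pair_roots k n"
    proof safe
      fix x assume "x \<in> pair_roots k (m * n)"
      hence "m dvd x * (x + k)" "n dvd x * (x + k)"
        by (auto simp: pair_roots_def intro: dvd_mult_left dvd_mult_right)
      thus "x mod m \<in> pair_roots k m" "x mod n \<in> pair_roots k n"
        using assms by (simp_all add: pair_roots_def dvd_mod_pair_iff)
    next
      fix a b assume a: "a \<in> pair_roots k m" and b: "b \<in> pair_roots k n"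
      obtain x where x: "x < m * n" "x mod m = a" "x mod n = b"
        using binary_chinese_remainder_unique_nat[OF assms(1), of a b] assms a b
        by (auto simp: Cong.cong_def pair_roots_def)
      have "m dvd x * (x + k)" "n dvd x * (x + k)"
        using a b x dvd_mod_pair_iff[of m x k] dvd_mod_pair_iff[of n x k]
        by (auto simp: pair_roots_def)
      hence "x \<in> pair_roots k (m * n)"
        using x assms(1) by (auto simp: pair_roots_def intro: divides_mult)
      thus "(a, b) \<in> (\<lambda>x. (x mod m, x mod n)) ` pair_roots k (m * n)"
        using x by force
    qed
  qed
  thus ?thesis using bij_betw_same_card card_cartesian_product by metis
qed

text \<open>The roots are the classes of 0 and \<open>-k\<close>, which coincide exactly when
  \<open>p\<close> divides \<open>k\<close>.\<close>

lemma card_pair_roots_prime: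
  assumes "prime p"
  shows "card (pair_roots k p) = pair_density k p"
proof -
  have p: "p > 0" using assms by (simp add: prime_gt_0_nat)
  have mem: "r \<in> pair_roots k p \<longleftrightarrow> r < p \<and> (r = 0 \<or> p dvd r + k)" for r
    using assms by (auto simp: pair_roots_def prime_dvd_mult_iff dest: nat_dvd_not_less)
  show ?thesis
  proof (cases "p dvd k")
    case True
    hence "pair_roots k p = {0}" using p
      by (auto simp: mem dvd_add_left_iff) (metis dvd_imp_le gr0I linorder_not_le)
    thus ?thesis using True by (simp add: pair_density_def)
  next
    case False
    hence km: "0 < k mod p" "k mod p < p" using p by (auto simp: dvd_eq_mod_eq_0)
    have *: "p dvd r + k \<longleftrightarrow> r = p - k mod p" if "r < p" for r
    proof -
      have "p dvd r + k \<longleftrightarrow> p dvd r + k mod p" by (simp add: dvd_eq_mod_eq_0 mod_simps)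
      also have "\<dots> \<longleftrightarrow> r + k mod p = p"
      proof
        assume "p dvd r + k mod p"
        then obtain c where c: "r + k mod p = p * c" by (elim dvdE)
        have "p * c < p * 2" "0 < p * c" using that km c by linarith+
        hence "c = 1" by (simp add: mult_less_cancel1)
        thus "r + k mod p = p" using c by simp
      qed simp
      finally show ?thesis using km by linarith
    qed
    have "pair_roots k p = {0, p - k mod p}"
    proof (rule set_eqI)
      fix r
      show "r \<in> pair_roots k p \<longleftrightarrow> r \<in> {0, p - k mod p}"
        unfolding mem using *[of r] km by (cases "r < p") auto
    qed
    thus ?thesis using False km by (simp add: pair_density_def)
  qed
qed

lemma coprime_prod_primes:
  assumes "finite A" "\<And>q. q \<in> A \<Longrightarrow> prime q" "prime (p::nat)" "p \<notin> A"
  shows "coprime p (\<Prod>A)"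
  using assms by (intro prod_coprime_right) (auto intro: primes_coprime)

lemma card_pair_roots_prod:
  assumes "finite A" "\<And>p. p \<in> A \<Longrightarrow> prime p"
  shows "card (pair_roots k (\<Prod>A)) = (\<Prod>p\<in>A. pair_density k p)"
  using assms
proof (induction A rule: finite_induct)
  case empty
  have "pair_roots k 1 = {0}" by (auto simp: pair_roots_def)
  thus ?case by simp
next
  case (insert p A)
  have "coprime p (\<Prod>A)" using insert by (intro coprime_prod_primes) auto
  moreover have "p > 0" "\<Prod>A > 0" using insert by (auto intro!: prod_pos prime_gt_0_nat)
  ultimately have "card (pair_roots k (p * \<Prod>A)) = card (pair_roots k p) * card (pair_roots k (\<Prod>A))"
    by (rule card_pair_roots_mult)
  thus ?case using insert by (simp add: card_pair_roots_prime)
qed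

lemma prod_primes_dvd_iff:
  assumes "finite A" "\<And>p. p \<in> A \<Longrightarrow> prime (p::nat)"
  shows "\<Prod>A dvd n \<longleftrightarrow> (\<forall>p\<in>A. p dvd n)"
  using assms
proof (induction A rule: finite_induct)
  case (insert p A)
  have "coprime p (\<Prod>A)" using insert by (intro coprime_prod_primes) auto
  hence "p * \<Prod>A dvd n \<longleftrightarrow> p dvd n \<and> \<Prod>A dvd n"
    by (auto intro: divides_mult dvd_mult_left dvd_mult_right)
  thus ?case using insert by simp
qed simp

text \<open>The condition selects certain residue classes modulo the product of \<open>A\<close>, as
  many as the right-hand side says, and each class deviates from its expected share by at most 1.
  The main term is written with \<open>p / pair_density k p\<close> to match the function
  \<open>f\<close> of \<open>selberg_weights\<close>.\<close>

lemma sieve_count: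
  assumes "finite A" "\<And>p. p \<in> A \<Longrightarrow> prime p"
  shows "\<bar>real (card {n\<in>{1..N}. \<forall>p\<in>A. p dvd n * (n + k)}) -
           real N / (\<Prod>p\<in>A. real p / real (pair_density k p))\<bar> \<le> (\<Prod>p\<in>A. real (pair_density k p))"
proof -
  define d where "d = \<Prod>A"
  have d: "d > 0" unfolding d_def using assms by (auto intro!: prod_pos prime_gt_0_nat)
  have "{n\<in>{1..N}. \<forall>p\<in>A. p dvd n * (n + k)} = (\<Union>r\<in>pair_roots k d. {n\<in>{1..N}. n mod d = r})"
    using d by (auto simp: d_def pair_roots_def dvd_mod_pair_iff simp flip: prod_primes_dvd_iff[OF assms])
  hence "card {n\<in>{1..N}. \<forall>p\<in>A. p dvd n * (n + k)} = (\<Sum>r\<in>pair_roots k d. card {n\<in>{1..N}. n mod d = r})"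
    by (subst card_UN_disjoint[symmetric]) auto
  moreover have c: "real (card (pair_roots k d)) = (\<Prod>p\<in>A. real (pair_density k p))"
    unfolding d_def by (subst card_pair_roots_prod[OF assms]) auto
  moreover have "real N / (\<Prod>p\<in>A. real p / real (pair_density k p)) =
      real (card (pair_roots k d)) * (real N / real d)"
    unfolding c by (simp add: prod_dividef d_def)
  ultimately have "\<bar>real (card {n\<in>{1..N}. \<forall>p\<in>A. p dvd n * (n + k)}) -
      real N / (\<Prod>p\<in>A. real p / real (pair_density k p))\<bar> =
      \<bar>\<Sum>r\<in>pair_roots k d. real (card {n\<in>{1..N}. n mod d = r}) - real N / real d\<bar>"
    by (simp add: sum_subtractf)
  also have "\<dots> \<le> (\<Sum>r\<in>pair_roots k d. 1)"
    by (intro order_trans[OF sum_abs] sum_mono card_mod_eq_bound) (auto simp: pair_roots_def)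
  also have "\<dots> = (\<Prod>p\<in>A. real (pair_density k p))" by (simp add: c)
  finally show ?thesis .
qed

text \<open>The prime \<open>2\<close> is left out of the sieve, since for odd \<open>k\<close> both residue classes modulo \<open>2\<close> are
  excluded and the Selberg weight \<open>1 / (p / \<rho>(p) - 1)\<close> degenerates. This costs only a constant factor.\<close>
definition odd_primes_upto :: "nat \<Rightarrow> nat set" where
  "odd_primes_upto z = {p. prime p \<and> odd p \<and> p \<le> z}"

definition sieve_support :: "nat \<Rightarrow> nat set set" where
  "sieve_support z = {A. A \<subseteq> odd_primes_upto z \<and> \<Prod>A \<le> z}"

text \<open>The denominator \<open>V\<close> of \<open>selberg_weights\<close> for this problem:
  with \<open>\<rho> = pair_density k\<close>, the classical sum over odd squarefree numbers up to
  \<open>z\<close> of the multiplicative function with value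
  \<open>\<rho> p / (p - \<rho> p)\<close> at \<open>p\<close>.\<close>

definition pair_sieve_sum :: "nat \<Rightarrow> nat \<Rightarrow> real" where
  "pair_sieve_sum k z = (\<Sum>A\<in>sieve_support z. \<Prod>p\<in>A. 1 / (real p / real (pair_density k p) - 1))"

section \<open>Sets of primes as squarefree numbers, and the resulting sieve bound\<close>

lemma finite_odd_primes_upto [simp]: "finite (odd_primes_upto z)"
  by (rule finite_subset[of _ "{..z}"]) (auto simp: odd_primes_upto_def)

lemma finite_sieve_support [simp]: "finite (sieve_support z)"
  by (rule finite_subset[of _ "Pow (odd_primes_upto z)"]) (auto simp: sieve_support_def)

lemma odd_prime_ge_3: "prime (p::nat) \<Longrightarrow> odd p \<Longrightarrow> p \<ge> 3"
  using prime_ge_2_nat[of p] by (cases "p = 2") auto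

lemma sieve_supportD:
  assumes "A \<in> sieve_support z"
  shows "finite A" "\<And>p. p \<in> A \<Longrightarrow> prime p" "\<And>p. p \<in> A \<Longrightarrow> odd p" "\<And>p. p \<in> A \<Longrightarrow> p \<ge> 3"
    "\<Prod>A \<le> z"
proof -
  have A: "A \<subseteq> odd_primes_upto z" "\<Prod>A \<le> z" using assms by (auto simp: sieve_support_def)
  show "finite A" using A(1) by (rule finite_subset) simp
  show "\<Prod>A \<le> z" by fact
  show "prime p" "odd p" "p \<ge> 3" if "p \<in> A" for p
    using A(1) that odd_prime_ge_3[of p] by (auto simp: odd_primes_upto_def)
qed

lemma sieve_support_subset:
  assumes "A \<in> sieve_support z" "B \<subseteq> A"
  shows "B \<in> sieve_support z"
proof -
  note A = sieve_supportD[OF assms(1)]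
  have "\<Prod>B \<le> \<Prod>A" using A assms(2)
    by (intro dvd_imp_le prod_dvd_prod_subset) (auto intro!: prod_pos prime_gt_0_nat)
  thus ?thesis using assms A by (auto simp: sieve_support_def)
qed

text \<open>Unique factorization: the set is recovered as the primes dividing its product.\<close>

lemma inj_on_prod_primes: "inj_on (\<lambda>A. \<Prod>A) {A. finite A \<and> (\<forall>p\<in>A. prime (p::nat))}"
proof (rule inj_onI)
  fix A B :: "nat set"
  assume A: "A \<in> {A. finite A \<and> (\<forall>p\<in>A. prime p)}" and B: "B \<in> {A. finite A \<and> (\<forall>p\<in>A. prime p)}"
    and eq: "\<Prod>A = \<Prod>B"
  have *: "X = {p. prime p \<and> p dvd \<Prod>X}" if X: "finite X" "\<forall>p\<in>X. prime p" for X :: "nat set"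
  proof (intro equalityI subsetI)
    fix p assume "p \<in> {p. prime p \<and> p dvd \<Prod>X}"
    then obtain x where "x \<in> X" "p dvd x" "prime p" using X prime_dvd_prod_iff[of X p id] by auto
    thus "p \<in> X" using X primes_dvd_imp_eq[of p x] by auto
  qed (use X dvd_prodI[of X _ id] in auto)
  have "A = {p. prime p \<and> p dvd \<Prod>A}" using A by (intro *) auto
  also have "\<dots> = B" unfolding eq using B by (intro *[symmetric]) auto
  finally show "A = B" .
qed

lemma card_sieve_support: "card (sieve_support z) \<le> z"
proof -
  have "inj_on (\<lambda>A. \<Prod>A) (sieve_support z)"
    by (rule inj_on_subset[OF inj_on_prod_primes]) (auto dest: sieve_supportD)
  moreover have "(\<lambda>A. \<Prod>A) ` sieve_support z \<subseteq> {1..z}"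
    using sieve_supportD prime_gt_0_nat by (fastforce simp: Suc_le_eq intro!: prod_pos)
  ultimately have "card (sieve_support z) \<le> card {1..z}" by (intro card_inj_on_le) auto
  thus ?thesis by simp
qed

lemma pair_density_bounds: "1 \<le> pair_density k p" "pair_density k p \<le> 2"
  by (auto simp: pair_density_def)

text \<open>The exponent 6 comes from a crude remainder: at most \<open>z\<close> sets in the
  support, each contributing at most \<open>z^2\<close>, and the resulting \<open>z^3\<close> is
  squared.\<close>

lemma pair_sieve:
  assumes "z > 0"
  shows "real (card {n\<in>{1..N}. \<forall>p\<in>odd_primes_upto z. \<not> p dvd n * (n + k)}) \<le>
           real N / pair_sieve_sum k z + real z ^ 6"
proof -
  define f where "f = (\<lambda>p. real p / real (pair_density k p))"
  define D where "D = sieve_support z"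
  define T where "T = {n\<in>{1..N}. \<forall>p\<in>odd_primes_upto z. \<not> p dvd n * (n + k)}"
  define R where "R = (\<lambda>A. \<Prod>p\<in>A. real (pair_density k p))"
  define C where "C = (\<lambda>A. {n\<in>{1..N}. \<forall>p\<in>A. p dvd n * (n + k)})"
  note D = sieve_supportD[of _ z, folded D_def]
  have finD [simp]: "finite D" by (simp add: D_def)
  have empty: "{} \<in> D" using assms by (simp add: D_def sieve_support_def)
  have dens: "1 \<le> real (pair_density k p)" "real (pair_density k p) \<le> 2" for p
    using pair_density_bounds[of k p] by auto
  have f1: "f p > 1" if "A \<in> D" "p \<in> A" for A p
  proof -
    have "real p \<ge> 3" using D(4)[OF that] by simp
    thus ?thesis using dens[of p] by (simp add: f_def less_divide_eq)
  qed
  obtain w where w: "w {} = 1" "\<And>A. A \<in> D \<Longrightarrow> \<bar>w A\<bar> \<le> (\<Prod>p\<in>A. f p / (f p - 1))"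
    "(\<Sum>A\<in>D. \<Sum>B\<in>D. w A * w B / (\<Prod>p\<in>A \<union> B. f p)) = 1 / pair_sieve_sum k z"
  proof (rule selberg_weights[of D f])
    fix w :: "nat set \<Rightarrow> real"
    assume w: "w {} = 1" "\<And>A. A \<in> D \<Longrightarrow> \<bar>w A\<bar> \<le> (\<Prod>p\<in>A. f p / (f p - 1))"
      "(\<Sum>A\<in>D. \<Sum>B\<in>D. w A * w B / (\<Prod>p\<in>A \<union> B. f p)) = 1 / (\<Sum>A\<in>D. \<Prod>p\<in>A. 1 / (f p - 1))"
    show thesis
      by (rule that[of w]) (fact w(1), fact w(2), use w(3) in \<open>simp only: pair_sieve_sum_def D_def f_def\<close>)
  next
    show "\<And>A B. A \<in> D \<Longrightarrow> B \<subseteq> A \<Longrightarrow> B \<in> D"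
      unfolding D_def by (rule sieve_support_subset)
  qed (simp_all add: D(1) empty f1)
  have wR: "\<bar>w A\<bar> * R A \<le> real z ^ 2" if A: "A \<in> D" for A
  proof -
    have "\<bar>w A\<bar> * R A \<le> (\<Prod>p\<in>A. f p / (f p - 1)) * R A"
      unfolding R_def by (intro mult_right_mono w(2) A prod_nonneg) auto
    also have "\<dots> = (\<Prod>p\<in>A. f p / (f p - 1) * real (pair_density k p))"
      unfolding R_def by (rule prod.distrib[symmetric])
    also have "\<dots> \<le> (\<Prod>p\<in>A. real p ^ 2)"
    proof (rule prod_mono)
      fix p assume p: "p \<in> A"
      define r where "r = real (pair_density k p)"
      have r: "1 \<le> r" "r \<le> 2" using dens by (auto simp: r_def)
      have p3: "real p \<ge> 3" using D(4)[OF A p] by simp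
      have "f p / (f p - 1) * r = real p * r / (real p - r)"
        using r p3 by (simp add: f_def r_def[symmetric] field_simps)
      moreover have "0 \<le> real p * r / (real p - r)" using r p3 by simp
      moreover have "real p * r / (real p - r) \<le> real p ^ 2"
      proof -
        have "real p * r \<le> real p * (real p * (real p - r))"
        proof (intro mult_left_mono)
          have "r \<le> real p * 1" using r p3 by linarith
          also have "\<dots> \<le> real p * (real p - r)" using r p3 by (intro mult_left_mono) auto
          finally show "r \<le> real p * (real p - r)" .
        qed auto
        thus ?thesis using r p3 by (simp add: divide_le_eq power2_eq_square mult.assoc)
      qed
      ultimately show "0 \<le> f p / (f p - 1) * real (pair_density k p) \<and>
          f p / (f p - 1) * real (pair_density k p) \<le> (real p)\<^sup>2"
        by (simp add: r_def)
    qed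
    also have "\<dots> = real (\<Prod>A) ^ 2" by (simp add: prod_power_distrib)
    also have "\<dots> \<le> real z ^ 2" using D(5)[OF A] by (intro power_mono) (simp_all flip: of_nat_prod)
    finally show ?thesis .
  qed
  have "real (card T) = (\<Sum>n\<in>T. 1)" by simp
  \<comment> \<open>For a sifted \<open>n\<close> only \<open>A = {}\<close> contributes, with
    weight 1. As the summand is a square, the sum may afterwards be extended to all \<open>n\<close>
    up to \<open>N\<close>.\<close>
  also have "\<dots> = (\<Sum>n\<in>T. (\<Sum>A\<in>D. if n \<in> C A then w A else 0) ^ 2)"
  proof (rule sum.cong[OF refl])
    fix n assume n: "n \<in> T"
    have "(if n \<in> C A then w A else 0) = (if A = {} then 1 else 0)" if "A \<in> D" for A
    proof (cases "A = {}")
      case False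
      then obtain p where "p \<in> A" by auto
      moreover have "A \<subseteq> odd_primes_upto z" using that by (simp add: D_def sieve_support_def)
      ultimately show ?thesis using n False by (auto simp: C_def T_def)
    qed (use n w(1) in \<open>simp add: C_def T_def\<close>)
    hence "(\<Sum>A\<in>D. if n \<in> C A then w A else 0) = (\<Sum>A\<in>D. if A = {} then 1 else 0)"
      by (intro sum.cong) auto
    also have "\<dots> = 1" using empty by simp
    finally show "1 = (\<Sum>A\<in>D. if n \<in> C A then w A else 0) ^ 2" by simp
  qed
  also have "\<dots> \<le> (\<Sum>n\<in>{1..N}. (\<Sum>A\<in>D. if n \<in> C A then w A else 0) ^ 2)"
    by (intro sum_mono2) (auto simp: T_def)
  also have "\<dots> = (\<Sum>n\<in>{1..N}. \<Sum>A\<in>D. \<Sum>B\<in>D. if n \<in> C (A \<union> B) then w A * w B else 0)"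
    unfolding power2_eq_square sum_product by (intro sum.cong refl) (auto simp: C_def)
  also have "\<dots> = (\<Sum>A\<in>D. \<Sum>B\<in>D. \<Sum>n\<in>{1..N}. if n \<in> C (A \<union> B) then w A * w B else 0)"
    by (subst sum.swap, intro sum.cong refl sum.swap)
  also have "\<dots> = (\<Sum>A\<in>D. \<Sum>B\<in>D. w A * w B * real (card (C (A \<union> B))))"
  proof (intro sum.cong refl)
    fix A B
    have "(\<Sum>n\<in>{1..N}. if n \<in> C (A \<union> B) then w A * w B else 0) = (\<Sum>n\<in>C (A \<union> B). w A * w B)"
      by (rule sum.mono_neutral_cong_right) (auto simp: C_def)
    thus "(\<Sum>n\<in>{1..N}. if n \<in> C (A \<union> B) then w A * w B else 0) = w A * w B * real (card (C (A \<union> B)))"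
      by simp
  qed
  also have "\<dots> \<le> (\<Sum>A\<in>D. \<Sum>B\<in>D. real N * (w A * w B / (\<Prod>p\<in>A \<union> B. f p)) +
      (\<bar>w A\<bar> * R A) * (\<bar>w B\<bar> * R B))"
  proof (intro sum_mono)
    fix A B assume A: "A \<in> D" and B: "B \<in> D"
    define e where "e = real (card (C (A \<union> B))) - real N / (\<Prod>p\<in>A \<union> B. f p)"
    have "\<bar>e\<bar> \<le> R (A \<union> B)"
      unfolding e_def C_def f_def R_def using D(1,2) A B by (intro sieve_count) auto
    \<comment> \<open>Inserting the factor \<open>R (A \<inter> B)\<close>, which is at least 1,
      turns the bound into \<open>R A * R B\<close>, so that the total error becomes a perfect
      square.\<close>
    also have "\<dots> * 1 \<le> R (A \<union> B) * R (A \<inter> B)"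
      unfolding R_def using dens(1) by (intro mult_left_mono prod_ge_1 prod_nonneg) auto
    also have "\<dots> = R A * R B"
      unfolding R_def using D(1) A B by (intro prod.union_inter) auto
    finally have e: "\<bar>e\<bar> \<le> R A * R B" by simp
    have "w A * w B * real (card (C (A \<union> B))) = real N * (w A * w B / (\<Prod>p\<in>A \<union> B. f p)) + w A * w B * e"
      by (simp add: e_def algebra_simps)
    also have "w A * w B * e \<le> \<bar>w A\<bar> * \<bar>w B\<bar> * \<bar>e\<bar>" by (simp flip: abs_mult)
    also have "\<dots> \<le> \<bar>w A\<bar> * \<bar>w B\<bar> * (R A * R B)" by (intro mult_left_mono e) auto
    finally show "w A * w B * real (card (C (A \<union> B))) \<le> real N * (w A * w B / (\<Prod>p\<in>A \<union> B. f p)) +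
      (\<bar>w A\<bar> * R A) * (\<bar>w B\<bar> * R B)" by (simp add: mult_ac)
  qed
  also have "\<dots> = real N * (\<Sum>A\<in>D. \<Sum>B\<in>D. w A * w B / (\<Prod>p\<in>A \<union> B. f p)) +
      (\<Sum>A\<in>D. \<bar>w A\<bar> * R A) ^ 2"
    unfolding power2_eq_square sum_product by (simp only: sum.distrib sum_distrib_left)
  also have "\<dots> = real N / pair_sieve_sum k z + (\<Sum>A\<in>D. \<bar>w A\<bar> * R A) ^ 2"
    by (simp add: w(3))
  also have "(\<Sum>A\<in>D. \<bar>w A\<bar> * R A) ^ 2 \<le> (real z * real z ^ 2) ^ 2"
  proof (rule power_mono)
    have "(\<Sum>A\<in>D. \<bar>w A\<bar> * R A) \<le> (\<Sum>A\<in>D. real z ^ 2)" by (intro sum_mono wR)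
    also have "\<dots> = real (card D) * real z ^ 2" by simp
    also have "\<dots> \<le> real z * real z ^ 2"
      using card_sieve_support[of z] by (intro mult_right_mono) (auto simp: D_def)
    finally show "(\<Sum>A\<in>D. \<bar>w A\<bar> * R A) \<le> real z * real z ^ 2" .
    show "0 \<le> (\<Sum>A\<in>D. \<bar>w A\<bar> * R A)" unfolding R_def by (intro sum_nonneg mult_nonneg_nonneg prod_nonneg) auto
  qed
  also have "(real z * real z ^ 2) ^ 2 = real z ^ 6" by (simp add: power_mult_distrib flip: power_Suc power_mult)
  finally show ?thesis by (simp add: T_def)
qed

subsection \<open>The main term of the sieve\<close>

lemma ln_le_sum_inverse: "ln (real y + 1) \<le> (\<Sum>n\<in>{1..y}. 1 / real n)"
proof (induction y)
  case (Suc y)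
  have "1 + 1 / (real y + 1) = (real (Suc y) + 1) / (real y + 1)" by (simp add: field_simps)
  hence "ln (real (Suc y) + 1) - ln (real y + 1) = ln (1 + 1 / (real y + 1))"
    by (simp add: ln_div)
  also have "\<dots> \<le> 1 / (real y + 1)" by (rule ln_add_one_self_le_self) simp
  finally show ?case using Suc by (simp add: add.commute)
qed simp

text \<open>The term \<open>1 / real y\<close> makes the induction telescope; at
  \<open>y = 0\<close> it has the value 0.\<close>

lemma sum_inverse_squares_le: "(\<Sum>m\<in>{1..y}. 1 / (real m)\<^sup>2) \<le> 2 - 1 / real y"
proof (induction y)
  case (Suc y)
  have "1 / (real (Suc y))\<^sup>2 \<le> 1 / real y - 1 / real (Suc y)" if "y > 0"
    using that by (simp add: divide_simps power2_eq_square)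
  with Suc show ?case by (cases "y = 0") auto
qed simp

lemma squarefree_eq_prod_prime_factors:
  assumes "squarefree (n::nat)"
  shows "\<Prod>(prime_factors n) = n"
proof -
  have n0: "n \<noteq> 0" using assms by (metis not_squarefree_0)
  have "n = (\<Prod>p\<in>prime_factors n. p ^ multiplicity p n)" using prod_prime_factors[OF n0] by simp
  also have "\<dots> = \<Prod>(prime_factors n)"
    using assms n0 by (intro prod.cong) (auto simp: squarefree_factorial_semiring'[OF n0])
  finally show ?thesis ..
qed

text \<open>Every \<open>n\<close> is uniquely a squarefree number times a square, and the
  squarefree part is an odd one times 1 or 2. Hence the harmonic sum is at most the right-hand sum
  times \<open>1 + 1 / 2\<close> times the sum of inverse squares, which is at most 2; this is the
  factor 3.\<close>

lemma sum_sieve_support_inverse_ge: "ln (real y + 1) / 3 \<le> (\<Sum>A\<in>sieve_support y. 1 / real (\<Prod>A))"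
proof -
  define h where "h = (\<lambda>(A :: nat set, b, m). 1 / real (\<Prod>A) * (if b then 1 / 2 else 1) * (1 / (real m)\<^sup>2))"
  define \<phi> where "\<phi> = (\<lambda>n::nat. (prime_factors (squarefree_part n) - {2}, even (squarefree_part n), square_part n))"
  have decomp: "\<Prod>(prime_factors (squarefree_part n) - {2}) * (if even (squarefree_part n) then 2 else 1)
      = squarefree_part n" for n :: nat
  proof -
    have "2 \<in> prime_factors (squarefree_part n) \<longleftrightarrow> even (squarefree_part n)"
      by (auto simp: prime_factors_dvd)
    thus ?thesis
      using squarefree_eq_prod_prime_factors[OF squarefree_squarefree_part[of n]]
        prod.remove[of "prime_factors (squarefree_part n)" 2 id]
      by (auto simp: mult.commute)
  qed
  have inj: "inj_on \<phi> {1..y}"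
  proof (rule inj_onI)
    fix m n assume "\<phi> m = \<phi> n"
    hence eq: "prime_factors (squarefree_part m) - {2} = prime_factors (squarefree_part n) - {2}"
      "even (squarefree_part m) = even (squarefree_part n)" and sq: "square_part m = square_part n"
      unfolding \<phi>_def prod.inject by blast+
    have "squarefree_part m = squarefree_part n"
      using decomp[of m] decomp[of n] unfolding eq by (rule trans[OF sym])
    with sq show "m = n" by (rule squarefree_decomposition_unique)
  qed
  have im: "\<phi> ` {1..y} \<subseteq> sieve_support y \<times> UNIV \<times> {1..y}"
  proof
    fix t assume "t \<in> \<phi> ` {1..y}"
    then obtain n where n: "n \<ge> 1" "n \<le> y" "t = \<phi> n" by auto
    have "squarefree_part n dvd n" by (metis dvd_triv_left squarefree_decompose)
    moreover have "square_part n dvd n" by (metis dvd_mult_right power2_eq_square square_part_square_dvd)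
    ultimately have le: "squarefree_part n \<le> n" "square_part n \<le> n" using n by (auto intro: dvd_imp_le)
    have s0: "square_part n > 0" using n square_part_0_iff[of n] by linarith
    have p0: "\<Prod>(prime_factors (squarefree_part n) - {2}) \<le> squarefree_part n"
      using dvd_triv_left[of "\<Prod>(prime_factors (squarefree_part n) - {2})"] decomp[of n]
        squarefree_part_nonzero[of n] by (metis dvd_imp_le gr0I)
    have "prime p \<Longrightarrow> odd p \<or> p = 2" for p :: nat using primes_dvd_imp_eq[of 2 p] by auto
    moreover have "p \<le> y" if "p \<in> prime_factors (squarefree_part n)" for p
      using dvd_imp_le[OF in_prime_factors_imp_dvd[OF that]] squarefree_part_nonzero[of n] le n by linarith
    ultimately have "prime_factors (squarefree_part n) - {2} \<in> sieve_support y"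
      using p0 le n by (auto simp: sieve_support_def odd_primes_upto_def)
    thus "t \<in> sieve_support y \<times> UNIV \<times> {1..y}" using n s0 le by (auto simp: \<phi>_def)
  qed
  have val: "1 / real n = h (\<phi> n)" for n
  proof -
    have "real n = real (\<Prod>(prime_factors (squarefree_part n) - {2})) *
       real (if even (squarefree_part n) then 2 else 1) * (real (square_part n))\<^sup>2"
      by (metis decomp of_nat_mult of_nat_power squarefree_decompose)
    thus ?thesis by (simp add: h_def \<phi>_def)
  qed
  have bools: "(\<Sum>b\<in>UNIV. \<Sum>m\<in>M. c * (if b then 1 / 2 else 1) * q m) = c * (3 / 2) * (\<Sum>m\<in>M. q m)"
    for c :: real and q and M :: "nat set"
    by (simp add: UNIV_bool flip: sum_distrib_left)
  have "ln (real y + 1) \<le> (\<Sum>n\<in>{1..y}. h (\<phi> n))"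
    using ln_le_sum_inverse[of y] by (simp add: val)
  also have "\<dots> = (\<Sum>t\<in>\<phi> ` {1..y}. h t)" using inj by (simp add: sum.reindex)
  also have "\<dots> \<le> (\<Sum>t\<in>sieve_support y \<times> UNIV \<times> {1..y}. h t)"
    using im by (intro sum_mono2) (auto simp: h_def simp del: of_nat_prod)
  also have "\<dots> = (\<Sum>A\<in>sieve_support y. \<Sum>b\<in>UNIV. \<Sum>m\<in>{1..y}.
      1 / real (\<Prod>A) * (if b then 1 / 2 else 1) * (1 / (real m)\<^sup>2))"
    by (simp add: sum.cartesian_product h_def del: of_nat_prod)
  also have "\<dots> = (\<Sum>A\<in>sieve_support y. 1 / real (\<Prod>A)) * (3 / 2) * (\<Sum>m\<in>{1..y}. 1 / (real m)\<^sup>2)"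
    by (simp only: bools sum_distrib_right)
  also have "\<dots> \<le> (\<Sum>A\<in>sieve_support y. 1 / real (\<Prod>A)) * (3 / 2) * 2"
    using sum_inverse_squares_le[of y] by (intro mult_left_mono mult_nonneg_nonneg sum_nonneg) (auto intro: order_trans simp del: of_nat_prod)
  finally show ?thesis by simp
qed

text \<open>Each \<open>p\<close> in \<open>U\<close> lies in \<open>A\<close> only, in
  \<open>B\<close> only, or in both, contributing \<open>1 / p\<close> twice and
  \<open>1 / p^2\<close> once. In the proof, \<open>B\<close> is \<open>U - A\<close> together with
  an arbitrary subset of \<open>A\<close>.\<close>

lemma sum_union_eq_prod:
  fixes U :: "nat set"
  assumes "finite U"
  shows "(\<Sum>(A, B) | A \<subseteq> U \<and> B \<subseteq> U \<and> A \<union> B = U. (\<Prod>p\<in>A. 1 / real p) * (\<Prod>p\<in>B. 1 / real p)) =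
    (\<Prod>p\<in>U. 2 / real p + 1 / (real p)\<^sup>2)"
proof -
  define r where "r = (\<lambda>p::nat. 1 / real p)"
  have fin: "finite A" if "A \<subseteq> U" for A using that assms finite_subset by blast
  have "(\<Sum>(A, B) | A \<subseteq> U \<and> B \<subseteq> U \<and> A \<union> B = U. prod r A * prod r B) =
        (\<Sum>(A, C)\<in>Sigma (Pow U) Pow. prod r A * (prod r (U - A) * prod r C))"
  proof (rule sum.reindex_bij_witness[of _ "\<lambda>(A, C). (A, (U - A) \<union> C)" "\<lambda>(A, B). (A, B \<inter> A)"])
    fix t assume t: "t \<in> {(A, B). A \<subseteq> U \<and> B \<subseteq> U \<and> A \<union> B = U}"
    obtain A B where AB: "t = (A, B)" "A \<subseteq> U" "B \<subseteq> U" "A \<union> B = U" using t by auto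
    have "prod r B = prod r (B - A) * prod r (B \<inter> A)"
      using fin[OF AB(3)] by (metis mult.commute prod.Int_Diff)
    also have "B - A = U - A" using AB by auto
    finally show "(case case t of (A, B) \<Rightarrow> (A, B \<inter> A) of (A, C) \<Rightarrow> prod r A * (prod r (U - A) * prod r C)) =
      (case t of (A, B) \<Rightarrow> prod r A * prod r B)" by (simp add: AB(1))
  qed auto
  also have "\<dots> = (\<Sum>A\<in>Pow U. \<Sum>C\<in>Pow A. prod r A * (prod r (U - A) * prod r C))"
    using assms fin by (subst sum.Sigma) auto
  also have "\<dots> = (\<Sum>A\<in>Pow U. (\<Prod>p\<in>A. r p * (1 + r p)) * (\<Prod>p\<in>U - A. r p))"
  proof (rule sum.cong[OF refl])
    fix A assume "A \<in> Pow U"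
    hence "finite A" using fin by auto
    have "(\<Sum>C\<in>Pow A. prod r A * (prod r (U - A) * prod r C)) = prod r A * prod r (U - A) * (\<Sum>C\<in>Pow A. prod r C)"
      by (simp add: sum_distrib_left mult.assoc)
    also have "(\<Sum>C\<in>Pow A. prod r C) = (\<Prod>p\<in>A. 1 + r p)"
      using prod_one_plus_Pow[OF \<open>finite A\<close>, of r] by simp
    finally show "(\<Sum>C\<in>Pow A. prod r A * (prod r (U - A) * prod r C)) = (\<Prod>p\<in>A. r p * (1 + r p)) * (\<Prod>p\<in>U - A. r p)"
      by (simp add: prod.distrib mult_ac)
  qed
  also have "\<dots> = (\<Prod>p\<in>U. r p * (1 + r p) + r p)" using assms by (rule prod_add[symmetric])
  also have "\<dots> = (\<Prod>p\<in>U. 2 / real p + 1 / (real p)\<^sup>2)"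
    by (intro prod.cong) (auto simp: r_def algebra_simps power2_eq_square)
  finally show ?thesis by (simp only: r_def)
qed

text \<open>Expanding the square and collecting pairs \<open>(A, B)\<close> by \<open>U = A \<union> B\<close> produces the local factors
  \<open>2 / p + 1 / p\<^sup>2\<close>. These are dominated by the sieve factor, except that at primes dividing \<open>k\<close>
  an additional \<open>1 / p\<close> is required, which the product on the right supplies.\<close>
lemma pair_sieve_sum_ge:
  assumes "k > 0"
  shows "(\<Sum>A\<in>sieve_support y. 1 / real (\<Prod>A))\<^sup>2 \<le>
    pair_sieve_sum k (y\<^sup>2) * (\<Prod>p\<in>prime_factors k. 1 + 1 / real p)"
proof -
  define r where "r = (\<lambda>p::nat. 1 / real p)"
  define g where "g = (\<lambda>p. 1 / (real p / real (pair_density k p) - 1))"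
  define a where "a = (\<lambda>p. if p dvd k then 1 / real p else 0)"
  define D where "D = sieve_support (y\<^sup>2)"
  define P where "P = odd_primes_upto (y\<^sup>2)"
  have rprod: "1 / real (\<Prod>A) = prod r A" for A by (simp add: r_def prod_dividef)
  have anonneg: "a p \<ge> 0" for p by (simp add: a_def)
  have g_nonneg: "g p \<ge> 0" if "p \<ge> 3" for p
    using that by (auto simp: g_def pair_density_def field_simps)
  have local_bound: "2 / real p + 1 / (real p)\<^sup>2 \<le> a p + g p" if "p \<ge> 3" for p
  proof (cases "p dvd k")
    case True
    have "1 / real p + 1 / (real p)\<^sup>2 \<le> 1 / (real p - 1)"
      using that by (simp add: divide_simps power2_eq_square) (simp add: algebra_simps)
    thus ?thesis using True by (simp add: a_def g_def pair_density_def)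
  next
    case False
    have "g p = 2 / (real p - 2)" using False that by (simp add: g_def pair_density_def field_simps)
    moreover have "2 / real p + 1 / (real p)\<^sup>2 \<le> 2 / (real p - 2)"
      using that by (simp add: divide_simps power2_eq_square) (simp add: algebra_simps)
    ultimately show ?thesis using False by (simp add: a_def)
  qed
  have D: "finite U" "\<And>p. p \<in> U \<Longrightarrow> p \<ge> 3" "U \<subseteq> P" if "U \<in> D" for U
    using that sieve_supportD(1,4)[of U "y\<^sup>2"] by (simp_all add: D_def P_def, simp add: sieve_support_def)
  \<comment> \<open>The lcm of two numbers up to \<open>y\<close> is at most \<open>y^2\<close>;
    this is why the sieve sum is taken at level \<open>y^2\<close>.\<close>
  have union: "A \<union> B \<in> D" if "A \<in> sieve_support y" "B \<in> sieve_support y" for A B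
  proof -
    note A = sieve_supportD[OF that(1)] and B = sieve_supportD[OF that(2)]
    have "\<Prod>(A \<union> B) * \<Prod>(A \<inter> B) = \<Prod>A * \<Prod>B"
      using prod.union_inter[OF A(1) B(1), of id] by simp
    moreover have "0 < \<Prod>(A \<inter> B)" using A(2) by (intro prod_pos) (auto intro: prime_gt_0_nat)
    hence "\<Prod>(A \<union> B) \<le> \<Prod>(A \<union> B) * \<Prod>(A \<inter> B)" by simp
    moreover have "\<Prod>A * \<Prod>B \<le> y\<^sup>2" unfolding power2_eq_square using A(5) B(5) by (rule mult_le_mono)
    ultimately have "\<Prod>(A \<union> B) \<le> y\<^sup>2" by linarith
    moreover have "y \<le> y\<^sup>2" by (simp add: power2_eq_square)
    hence "odd_primes_upto y \<subseteq> odd_primes_upto (y\<^sup>2)" by (auto simp: odd_primes_upto_def)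
    ultimately show ?thesis using that unfolding D_def sieve_support_def by blast
  qed
  have "(\<Sum>A\<in>sieve_support y. 1 / real (\<Prod>A))\<^sup>2 = (\<Sum>(A, B)\<in>sieve_support y \<times> sieve_support y. prod r A * prod r B)"
    unfolding rprod power2_eq_square sum_product by (simp add: sum.cartesian_product)
  also have "\<dots> = (\<Sum>U\<in>D. \<Sum>t\<in>{t \<in> sieve_support y \<times> sieve_support y. fst t \<union> snd t = U}.
      case t of (A, B) \<Rightarrow> prod r A * prod r B)"
    using union by (intro sum.group[symmetric]) (auto simp: D_def)
  also have "\<dots> \<le> (\<Sum>U\<in>D. \<Sum>t\<in>{(A, B). A \<subseteq> U \<and> B \<subseteq> U \<and> A \<union> B = U}. case t of (A, B) \<Rightarrow> prod r A * prod r B)"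
  proof (intro sum_mono sum_mono2)
    fix U assume "U \<in> D"
    hence "finite (Pow U \<times> Pow U)" using D(1) by simp
    thus "finite {(A, B). A \<subseteq> U \<and> B \<subseteq> U \<and> A \<union> B = U}" by (rule rev_finite_subset) auto
  qed (auto simp: r_def intro!: mult_nonneg_nonneg prod_nonneg)
  also have "\<dots> = (\<Sum>U\<in>D. \<Prod>p\<in>U. 2 / real p + 1 / (real p)\<^sup>2)"
    using D(1) by (intro sum.cong refl) (simp only: r_def sum_union_eq_prod)
  also have "\<dots> \<le> (\<Sum>U\<in>D. \<Prod>p\<in>U. a p + g p)"
    using D(2) local_bound by (intro sum_mono prod_mono) auto
  also have "\<dots> = (\<Sum>U\<in>D. \<Sum>T\<in>Pow U. prod a T * prod g (U - T))"
    using D(1) by (intro sum.cong refl prod_add) auto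
  also have "\<dots> = (\<Sum>(U, T)\<in>Sigma D Pow. prod a T * prod g (U - T))"
    using D(1) by (subst sum.Sigma) (auto simp: D_def)
  \<comment> \<open>The map is injective and \<open>U - T\<close> stays in \<open>D\<close>.
    Forgetting that \<open>T \<union> E\<close> must lie in \<open>D\<close> enlarges the sum, whose
    terms are nonnegative, to one that factors.\<close>
  also have "\<dots> = (\<Sum>(T, E)\<in>(\<lambda>(U, T). (T, U - T)) ` Sigma D Pow. prod a T * prod g E)"
    by (subst sum.reindex) (auto simp: inj_on_def case_prod_unfold intro!: sum.cong)
  also have "\<dots> \<le> (\<Sum>(T, E)\<in>Pow P \<times> D. prod a T * prod g E)"
  proof (rule sum_mono2)
    show "(\<lambda>(U, T). (T, U - T)) ` Sigma D Pow \<subseteq> Pow P \<times> D"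
      using D(3) sieve_support_subset[of _ "y\<^sup>2", folded D_def] by fastforce
    show "finite (Pow P \<times> D)" by (simp add: P_def D_def)
  qed (auto intro!: mult_nonneg_nonneg prod_nonneg anonneg g_nonneg dest: D(2))
  also have "\<dots> = (\<Sum>T\<in>Pow P. prod a T) * (\<Sum>E\<in>D. prod g E)"
    by (simp add: sum_product sum.cartesian_product)
  also have "(\<Sum>E\<in>D. prod g E) = pair_sieve_sum k (y\<^sup>2)"
    by (simp add: pair_sieve_sum_def D_def g_def)
  also have "(\<Sum>T\<in>Pow P. prod a T) = (\<Prod>p\<in>P. 1 + a p)"
    by (rule prod_one_plus_Pow[symmetric]) (simp add: P_def)
  also have "\<dots> = (\<Prod>p\<in>P \<inter> prime_factors k. 1 + 1 / real p)"
    using assms by (intro prod.mono_neutral_cong_right)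
      (auto simp: P_def a_def odd_primes_upto_def prime_factors_dvd)
  finally have "(\<Sum>A\<in>sieve_support y. 1 / real (\<Prod>A))\<^sup>2 \<le>
    (\<Prod>p\<in>P \<inter> prime_factors k. 1 + 1 / real p) * pair_sieve_sum k (y\<^sup>2)" .
  also have "\<dots> \<le> (\<Prod>p\<in>prime_factors k. 1 + 1 / real p) * pair_sieve_sum k (y\<^sup>2)"
  proof (intro mult_right_mono prod_mono2)
    show "0 \<le> pair_sieve_sum k (y\<^sup>2)"
      unfolding pair_sieve_sum_def using g_nonneg D(2) by (auto simp: g_def D_def intro!: sum_nonneg prod_nonneg)
  qed auto
  finally show ?thesis by (simp add: mult.commute)
qed

subsection \<open>Estimates of Chebyshev and Mertens\<close>

text \<open>From \<open>n\<close> to \<open>n + 1\<close>, the quotient \<open>n div d\<close> grows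
  by 1 exactly for divisors \<open>d\<close> of \<open>n + 1\<close>, and the von Mangoldt function
  sums to \<open>ln (n + 1)\<close> over these.\<close>

lemma ln_fact_eq_sum_mangoldt: "ln (fact n) = (\<Sum>d\<in>{1..n}. mangoldt d * real (n div d))"
proof (induction n)
  case (Suc n)
  have "(\<Sum>d\<in>{1..Suc n}. mangoldt d * real (Suc n div d)) =
    (\<Sum>d\<in>{1..Suc n}. mangoldt d * real (n div d) + (if d dvd Suc n then mangoldt d else 0))"
    by (intro sum.cong refl) (auto simp: div_Suc dvd_eq_mod_eq_0 algebra_simps)
  also have "\<dots> = (\<Sum>d\<in>{1..n}. mangoldt d * real (n div d)) + (\<Sum>d\<in>{1..Suc n}. if d dvd Suc n then mangoldt d else 0)"
    by (simp add: sum.distrib)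
  also have "(\<Sum>d\<in>{1..Suc n}. if d dvd Suc n then mangoldt d else 0 :: real) = (\<Sum>d | d dvd Suc n. mangoldt d)"
    by (rule sum.mono_neutral_cong_right) (auto simp: Suc_le_eq dvd_imp_le dvd_pos_nat[of "Suc n"])
  also have "\<dots> = ln (real (Suc n))" using mangoldt_sum[of "Suc n", where 'a = real] by simp
  finally show ?case using Suc by (simp add: ln_mult_pos)
qed simp

text \<open>Half of Mertens' first theorem: only the prime terms of \<open>ln (fact n)\<close> are
  kept, and \<open>fact n\<close> is at most \<open>n ^ n\<close>. The factor 2 pays for replacing
  \<open>n div p\<close> by \<open>n / (2 * p)\<close>.\<close>

lemma sum_ln_prime_over_le:
  assumes "n > 0"
  shows "(\<Sum>p | prime p \<and> p \<le> n. ln (real p) / real p) \<le> 2 * ln (real n)"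
proof -
  have fin: "finite {p. prime p \<and> p \<le> n}" by (rule finite_subset[of _ "{..n}"]) auto
  have "real n / 2 * (\<Sum>p | prime p \<and> p \<le> n. ln (real p) / real p) =
    (\<Sum>p | prime p \<and> p \<le> n. ln (real p) * (real n / real p / 2))"
    by (simp add: sum_distrib_left mult_ac)
  also have "\<dots> \<le> (\<Sum>p | prime p \<and> p \<le> n. mangoldt p * real (n div p))"
  proof (rule sum_mono)
    fix p assume "p \<in> {p. prime p \<and> p \<le> n}"
    hence p: "prime p" "p \<le> n" "p > 0" by (auto simp: prime_gt_0_nat)
    have "1 \<le> real (n div p)" using p div_le_mono[of p n p] by simp
    moreover have "real n / real p \<le> real (n div p) + 1"
    proof -
      have "real n = real p * real (n div p) + real (n mod p)" by (metis mult_div_mod_eq of_nat_add of_nat_mult)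
      moreover have "real (n mod p) < real p" using p by simp
      ultimately show ?thesis using p by (simp add: field_simps)
    qed
    ultimately have "real n / real p / 2 \<le> real (n div p)" by argo
    hence "ln (real p) * (real n / real p / 2) \<le> ln (real p) * real (n div p)"
      using p by (intro mult_left_mono) auto
    thus "ln (real p) * (real n / real p / 2) \<le> mangoldt p * real (n div p)"
      using p(1) by simp
  qed
  also have "\<dots> \<le> (\<Sum>p\<in>{1..n}. mangoldt p * real (n div p))"
    by (intro sum_mono2) (auto simp: mangoldt_nonneg Suc_le_eq prime_gt_0_nat)
  also have "\<dots> = ln (fact n)" by (rule ln_fact_eq_sum_mangoldt[symmetric])
  also have "\<dots> \<le> ln (real n ^ n)" using fact_le_power[of n, where 'a = real] assms by simp
  also have "\<dots> = real n * ln (real n)" using assms by (simp add: ln_realpow)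
  finally show ?thesis using assms by (simp add: field_simps)
qed

text \<open>Integral comparison: the right-hand side is 1 plus the integral of
  \<open>t powr (-1 - d)\<close> from 1 to \<open>M\<close>. The induction step rests on the
  Bernoulli-type bound that \<open>(1 - 1 / t) powr (-d)\<close> is at least
  \<open>1 + d / t\<close>.\<close>

lemma sum_powr_le:
  fixes d :: real
  assumes "d > 0" "M > 0"
  shows "(\<Sum>m\<in>{1..M}. real m powr (-1 - d)) \<le> 1 + (1 - real M powr (-d)) / d"
  using assms(2)
proof (induction M rule: nat_induct_non_zero)
  case (Suc M)
  define t where "t = real M + 1"
  have t: "t > 1" using Suc by (simp add: t_def)
  have "1 + d / t \<le> 1 + d * (- ln (1 - 1 / t))"
  proof -
    have "ln (1 - 1 / t) \<le> - (1 / t)" using ln_le_minus_one[of "1 - 1 / t"] t by simp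
    hence "d * (1 / t) \<le> d * (- ln (1 - 1 / t))" using assms(1) by (intro mult_left_mono) auto
    thus ?thesis by simp
  qed
  also have "\<dots> \<le> exp (d * (- ln (1 - 1 / t)))" by (rule exp_ge_add_one_self)
  also have "\<dots> = (1 - 1 / t) powr (-d)" using t by (simp add: powr_def)
  finally have "t powr (-d) * (1 + d / t) \<le> t powr (-d) * (1 - 1 / t) powr (-d)"
    by (intro mult_left_mono) auto
  also have "\<dots> = (t * (1 - 1 / t)) powr (-d)" using t by (subst powr_mult) auto
  also have "t * (1 - 1 / t) = real M" using t by (simp add: t_def field_simps)
  finally have "t powr (-d) + d * (t powr (-d) / t) \<le> real M powr (-d)" by (simp add: algebra_simps)
  moreover have "t powr (-d) / t = t powr (-1 - d)"
    using t by (simp add: powr_diff powr_minus field_simps)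
  ultimately have "t powr (-1 - d) \<le> (real M powr (-d) - t powr (-d)) / d"
    using assms(1) by (simp add: field_simps)
  moreover have "real (Suc M) = t" by (simp add: t_def)
  ultimately show ?case using Suc by (simp add: diff_divide_distrib)
qed simp

text \<open>Rankin's trick: with \<open>s = 1 + 1 / ln w\<close>, replacing \<open>1 / p\<close> by \<open>p powr (-s)\<close> costs a bounded factor, and
  the resulting product expands to a part of the series for \<open>\<zeta>(s) \<le> 1 + ln w\<close>.\<close>
lemma prod_primes_one_plus_inverse_le:
  assumes "w \<ge> 3"
  shows "(\<Prod>p | prime p \<and> p \<le> w. 1 + 1 / real p) \<le> 2 * exp 2 * ln (real w)"
proof -
  define L where "L = ln (real w)"
  define P where "P = {p::nat. prime p \<and> p \<le> w}"
  have fin: "finite P" unfolding P_def by (rule finite_subset[of _ "{..w}"]) auto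
  have "ln (exp 1) \<le> L" unfolding L_def using exp_le assms by (subst ln_le_cancel_iff) auto
  hence L: "L \<ge> 1" by simp
  \<comment> \<open>With \<open>u = ln p / L\<close>, \<open>p powr (-1 - 1 / L)\<close> equals
    \<open>exp (-u) / p\<close>, hence is at least \<open>(1 - u) / p\<close>. The deficit
    \<open>u / p\<close> goes into the exponential factor; these factors multiply to at most
    \<open>exp 2\<close> by \<open>sum_ln_prime_over_le\<close>.\<close>
  have "(\<Prod>p\<in>P. 1 + 1 / real p) \<le> (\<Prod>p\<in>P. (1 + real p powr (-1 - 1 / L)) * exp (ln (real p) / real p / L))"
  proof (rule prod_mono)
    fix p assume "p \<in> P"
    hence p: "real p > 1" using prime_gt_1_nat[of p] by (simp add: P_def)
    define u where "u = ln (real p) / L"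
    have u: "u \<ge> 0" using p L by (simp add: u_def)
    have "real p powr (-1 - 1 / L) = 1 / real p * exp (- u)"
      using p by (simp add: powr_def u_def left_diff_distrib exp_diff exp_minus field_simps)
    moreover have "1 / real p * (1 - u) \<le> 1 / real p * exp (- u)"
      using exp_ge_add_one_self[of "-u"] p by (intro mult_left_mono) auto
    ultimately have "1 + 1 / real p \<le> 1 + real p powr (-1 - 1 / L) + u / real p"
      by (simp add: diff_divide_distrib)
    also have "\<dots> \<le> (1 + real p powr (-1 - 1 / L)) * (1 + u / real p)"
      using u by (simp add: algebra_simps)
    also have "\<dots> \<le> (1 + real p powr (-1 - 1 / L)) * exp (u / real p)"
      by (intro mult_left_mono exp_ge_add_one_self) (auto intro: add_nonneg_nonneg)
    finally show "0 \<le> 1 + 1 / real p \<and> 1 + 1 / real p \<le> (1 + real p powr (-1 - 1 / L)) * exp (ln (real p) / real p / L)"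
      by (simp add: u_def mult.commute)
  qed
  also have "\<dots> = (\<Prod>p\<in>P. 1 + real p powr (-1 - 1 / L)) * exp ((\<Sum>p\<in>P. ln (real p) / real p) / L)"
    by (simp add: prod.distrib exp_sum fin sum_divide_distrib)
  also have "\<dots> \<le> (1 + L) * exp 2"
  proof (rule mult_mono)
    have Pp: "prime p" if "p \<in> P" for p using that by (simp add: P_def)
    have "(\<Prod>p\<in>P. 1 + real p powr (-1 - 1 / L)) = (\<Sum>A\<in>Pow P. \<Prod>p\<in>A. real p powr (-1 - 1 / L))"
      by (rule prod_one_plus_Pow[OF fin])
    also have "\<dots> = (\<Sum>A\<in>Pow P. real (\<Prod>A) powr (-1 - 1 / L))"
      by (intro sum.cong refl) (simp add: prod_powr_distrib)
    also have "\<dots> = (\<Sum>m\<in>(\<lambda>A. \<Prod>A) ` Pow P. real m powr (-1 - 1 / L))"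
      using Pp fin finite_subset[OF _ fin]
      by (subst sum.reindex) (auto intro!: inj_on_subset[OF inj_on_prod_primes])
    also have "\<dots> \<le> (\<Sum>m\<in>{1..\<Prod>P}. real m powr (-1 - 1 / L))"
    proof (rule sum_mono2)
      show "(\<lambda>A. \<Prod>A) ` Pow P \<subseteq> {1..\<Prod>P}"
      proof safe
        fix A assume "A \<subseteq> P"
        have "\<Prod>X > 0" if "X \<subseteq> P" for X
          using that Pp prime_gt_0_nat by (intro prod_pos) blast
        hence "\<Prod>A > 0" "\<Prod>P > 0" using \<open>A \<subseteq> P\<close> by blast+
        moreover have "\<Prod>A dvd \<Prod>P" using \<open>A \<subseteq> P\<close> fin by (rule prod_dvd_prod_subset[rotated])
        ultimately show "\<Prod>A \<in> {1..\<Prod>P}" by (auto intro: dvd_imp_le)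
      qed
    qed auto
    also have "\<dots> \<le> 1 + (1 - real (\<Prod>P) powr (- (1 / L))) / (1 / L)"
      using L Pp by (intro sum_powr_le prod_pos) (auto intro: prime_gt_0_nat)
    also have "\<dots> \<le> 1 + L" using L by (simp add: field_simps)
    finally show "(\<Prod>p\<in>P. 1 + real p powr (-1 - 1 / L)) \<le> 1 + L" .
    show "exp ((\<Sum>p\<in>P. ln (real p) / real p) / L) \<le> exp 2"
      using sum_ln_prime_over_le[of w] assms L by (simp add: P_def L_def divide_le_eq)
  qed (use L in auto)
  also have "\<dots> \<le> 2 * exp 2 * L" using L by (simp add: algebra_simps)
  finally show ?thesis by (simp add: P_def L_def)
qed

text \<open>A number up to \<open>2 ^ w\<close> has at most \<open>w\<close> prime factors above
  \<open>w\<close>, and together these contribute at most \<open>(1 + 1 / w) ^ w\<close>, which is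
  below \<open>exp 1\<close>. The smaller ones are covered by the product over all primes up to
  \<open>w\<close>.\<close>

lemma prod_prime_factors_one_plus_inverse_le:
  assumes "w \<ge> 3" "k > 0" "k \<le> 2 ^ w"
  shows "(\<Prod>p\<in>prime_factors k. 1 + 1 / real p) \<le> 2 * exp 3 * ln (real w)"
proof -
  define Q where "Q = {p \<in> prime_factors k. p > w}"
  have finQ: "finite Q" by (simp add: Q_def)
  have "2 ^ card Q \<le> (2::nat) ^ w"
  proof -
    have "2 ^ card Q = (\<Prod>p\<in>Q. 2::nat)" by simp
    also have "\<dots> \<le> \<Prod>Q" by (intro prod_mono) (auto simp: Q_def dest: in_prime_factors_imp_prime prime_ge_2_nat)
    also have "\<dots> \<le> k"
      by (intro dvd_imp_le assms, subst prod_primes_dvd_iff[OF finQ]) (auto simp: Q_def dest: in_prime_factors_imp_prime in_prime_factors_imp_dvd)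
    also have "\<dots> \<le> 2 ^ w" by fact
    finally show ?thesis .
  qed
  hence cardQ: "card Q \<le> w" by simp
  have "(\<Prod>p\<in>prime_factors k. 1 + 1 / real p) =
      (\<Prod>p\<in>prime_factors k \<inter> {..w}. 1 + 1 / real p) * (\<Prod>p\<in>prime_factors k - {..w}. 1 + 1 / real p)"
    by (rule prod.Int_Diff) simp
  also have "prime_factors k - {..w} = Q" by (auto simp: Q_def)
  also have "(\<Prod>p\<in>prime_factors k \<inter> {..w}. 1 + 1 / real p) * (\<Prod>p\<in>Q. 1 + 1 / real p) \<le> (2 * exp 2 * ln (real w)) * exp 1"
  proof (rule mult_mono)
    have "(\<Prod>p\<in>prime_factors k \<inter> {..w}. 1 + 1 / real p) \<le> (\<Prod>p | prime p \<and> p \<le> w. 1 + 1 / real p)"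
      by (rule prod_mono2) (auto dest: in_prime_factors_imp_prime intro: finite_subset[of _ "{..w}"])
    also have "\<dots> \<le> 2 * exp 2 * ln (real w)" by (rule prod_primes_one_plus_inverse_le) fact
    finally show "(\<Prod>p\<in>prime_factors k \<inter> {..w}. 1 + 1 / real p) \<le> 2 * exp 2 * ln (real w)" .
    have "(\<Prod>p\<in>Q. 1 + 1 / real p) \<le> (\<Prod>p\<in>Q. 1 + 1 / real w)"
      using assms by (intro prod_mono) (auto simp: Q_def intro!: divide_left_mono)
    also have "\<dots> = (1 + 1 / real w) ^ card Q" by simp
    also have "\<dots> \<le> (1 + 1 / real w) ^ w" using cardQ by (intro power_increasing) auto
    also have "\<dots> \<le> exp (1 / real w) ^ w" by (intro power_mono exp_ge_add_one_self) auto
    also have "\<dots> = exp 1" using assms by (simp flip: exp_of_nat_mult)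
    finally show "(\<Prod>p\<in>Q. 1 + 1 / real p) \<le> exp 1" .
  qed (use assms in \<open>auto intro!: prod_nonneg\<close>)
  also have "\<dots> = 2 * exp 3 * ln (real w)" using exp_add[of 2 "1::real"] by simp
  finally show ?thesis .
qed

section \<open>Chebyshev's lower bound for the number of primes\<close>

lemma sum_mangoldt_le:
  assumes "N > 0"
  shows "(\<Sum>d\<in>{1..N}. mangoldt d) \<le> real (card {p. prime p \<and> p \<le> N}) * ln (real N)"
proof -
  define P where "P = {p::nat. prime p \<and> p \<le> N}"
  define S where "S = {d\<in>{1..N}. primepow d}"
  have finP: "finite P" unfolding P_def by (rule finite_subset[of _ "{..N}"]) auto
  have aprimedivisor_in: "aprimedivisor d \<in> P" if "d \<in> S" for d
  proof -
    have d: "d > 1" "d \<le> N" using that primepow_gt_Suc_0[of d] by (auto simp: S_def)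
    hence "prime (aprimedivisor d)" "aprimedivisor d dvd d"
      using prime_aprimedivisor'[of d] aprimedivisor_dvd'[of d] by auto
    thus ?thesis using d by (auto simp: P_def dest: dvd_imp_le)
  qed
  have "(\<Sum>d\<in>{1..N}. mangoldt d) = (\<Sum>d\<in>S. ln (real (aprimedivisor d)))"
    by (rule sum.mono_neutral_cong_right) (auto simp: S_def mangoldt_def)
  also have "\<dots> = (\<Sum>p\<in>P. \<Sum>d\<in>{d\<in>S. aprimedivisor d = p}. ln (real (aprimedivisor d)))"
    using finP aprimedivisor_in by (intro sum.group[symmetric]) (auto simp: S_def)
  also have "\<dots> = (\<Sum>p\<in>P. real (card {d\<in>S. aprimedivisor d = p}) * ln (real p))"
    by (intro sum.cong refl) simp
  also have "\<dots> \<le> (\<Sum>p\<in>P. ln (real N))"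
  proof (rule sum_mono)
    fix p assume "p \<in> P"
    hence p: "prime p" "p > 1" using prime_gt_1_nat[of p] by (simp_all add: P_def)
    define J where "J = nat \<lfloor>ln (real N) / ln (real p)\<rfloor>"
    have lnp: "ln (real p) > 0" using p by simp
    have lnN: "ln (real N) \<ge> 0" using assms by simp
    \<comment> \<open>At most \<open>ln N / ln p\<close> powers of \<open>p\<close> are below
      \<open>N\<close>, and each carries weight \<open>ln p\<close>, so every prime contributes at
      most \<open>ln N\<close>.\<close>
    have "{d\<in>S. aprimedivisor d = p} \<subseteq> (\<lambda>j. p ^ j) ` {1..J}"
    proof
      fix d assume "d \<in> {d\<in>S. aprimedivisor d = p}"
      hence d: "d \<le> N" "primepow d" "aprimedivisor d = p" by (auto simp: S_def)
      obtain j where j: "j > 0" "d = p ^ j"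
        using primepow_decompose[OF d(2)] d p by (metis One_nat_def neq0_conv power_0 one_not_primepow)
      have "real j * ln (real p) = ln (real d)" using p by (simp add: j ln_realpow)
      also have "d > 0" using j p by simp
      hence "ln (real d) \<le> ln (real N)" using d(1) by simp
      finally have "real j \<le> ln (real N) / ln (real p)" using lnp by (simp add: field_simps)
      hence "j \<le> J" unfolding J_def by linarith
      thus "d \<in> (\<lambda>j. p ^ j) ` {1..J}" using j by auto
    qed
    hence "card {d\<in>S. aprimedivisor d = p} \<le> card ((\<lambda>j. p ^ j) ` {1..J})" by (intro card_mono) auto
    also have "\<dots> \<le> J" using card_image_le[of "{1..J}"] by simp
    finally have "real (card {d\<in>S. aprimedivisor d = p}) \<le> real J" by simp
    also have "\<dots> \<le> ln (real N) / ln (real p)"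
      unfolding J_def using lnp lnN by simp
    finally show "real (card {d\<in>S. aprimedivisor d = p}) * ln (real p) \<le> ln (real N)"
      using lnp by (simp add: field_simps)
  qed
  finally show ?thesis by (simp add: P_def)
qed

text \<open>The central binomial coefficient is at least \<open>4 ^ n / (2 * n)\<close>, while its
  logarithm is a von Mangoldt sum with coefficients \<open>2 * n div d - 2 * (n div d)\<close>,
  which are at most 1.\<close>

lemma chebyshev_lower_bound:
  assumes "n > 0"
  shows "2 * real n * ln 2 - ln (2 * real n) \<le> real (card {p. prime p \<and> p \<le> 2 * n}) * ln (2 * real n)"
proof -
  have "2 * real n * ln 2 - ln (2 * real n) = ln (4 ^ n / (2 * real n))"
    using assms ln_realpow[of "2::real" "2 * n"] by (simp add: ln_div power_mult)
  also have "\<dots> \<le> ln (real ((2 * n) choose n))"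
    using central_binomial_lower_bound[OF assms] assms
    by (subst ln_le_cancel_iff) (auto simp: zero_less_binomial)
  also have "real ((2 * n) choose n) = fact (2 * n) / (fact n * fact n)"
    by (subst binomial_fact) auto
  also have "ln \<dots> = ln (fact (2 * n)) - 2 * ln (fact n)"
    by (simp add: ln_div ln_mult_pos)
  \<comment> \<open>The terms with \<open>d > n\<close> vanish, which aligns the range with that of
    \<open>fact (2 * n)\<close>.\<close>
  also have "ln (fact n) = (\<Sum>d\<in>{1..2 * n}. mangoldt d * real (n div d))"
    unfolding ln_fact_eq_sum_mangoldt by (rule sum.mono_neutral_left) auto
  also have "ln (fact (2 * n)) - 2 * (\<Sum>d\<in>{1..2 * n}. mangoldt d * real (n div d)) =
     (\<Sum>d\<in>{1..2 * n}. mangoldt d * (real (2 * n div d) - 2 * real (n div d)))"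
    unfolding ln_fact_eq_sum_mangoldt by (simp add: sum_distrib_left sum_subtractf algebra_simps)
  also have "\<dots> \<le> (\<Sum>d\<in>{1..2 * n}. mangoldt d)"
  proof (rule sum_mono)
    fix d assume "d \<in> {1..2 * n}"
    hence "d > 0" by simp
    have "2 * n div d < 2 * (n div d) + 2"
    proof (rule div_less_iff_less_mult[THEN iffD2, OF \<open>d > 0\<close>])
      have "n = d * (n div d) + n mod d" by simp
      moreover have "n mod d < d" using \<open>d > 0\<close> by simp
      ultimately have "2 * n < 2 * (d * (n div d)) + 2 * d" by linarith
      thus "2 * n < (2 * (n div d) + 2) * d" by (simp add: algebra_simps)
    qed
    hence "real (2 * n div d) - 2 * real (n div d) \<le> 1" by linarith
    hence "mangoldt d * (real (2 * n div d) - 2 * real (n div d)) \<le> mangoldt d * 1"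
      by (intro mult_left_mono) (auto simp: mangoldt_nonneg)
    thus "mangoldt d * (real (2 * n div d) - 2 * real (n div d)) \<le> (mangoldt d :: real)" by simp
  qed
  also have "\<dots> \<le> real (card {p. prime p \<and> p \<le> 2 * n}) * ln (real (2 * n))"
    using assms by (intro sum_mangoldt_le) auto
  finally show ?thesis by simp
qed

subsection \<open>Representations as a sum\<close>

text \<open>Sieving by the odd primes up to \<open>y^2\<close> can lose only pairs with
  \<open>n\<close> at most \<open>y^2\<close>. These and the sieve error \<open>(y^2)^6\<close>
  together give \<open>2 * y^12\<close>; the 9 is the square of the 3 in
  \<open>sum_sieve_support_inverse_ge\<close>.\<close>

lemma prime_pair_count:
  assumes "y > 0" "k > 0"
  shows "real (card {n\<in>{1..N}. prime n \<and> prime (n + k)}) \<le>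
    9 * real N * (\<Prod>p\<in>prime_factors k. 1 + 1 / real p) / (ln (real y + 1))\<^sup>2 + 2 * real y ^ 12"
proof -
  define h where "h = (\<Prod>p\<in>prime_factors k. 1 + 1 / real p)"
  define V where "V = pair_sieve_sum k (y\<^sup>2)"
  define T where "T = {n\<in>{1..N}. \<forall>p\<in>odd_primes_upto (y\<^sup>2). \<not> p dvd n * (n + k)}"
  have h: "h > 0" unfolding h_def by (intro prod_pos) (auto intro: add_pos_nonneg)
  have L: "ln (real y + 1) > 0" using assms by simp
  have "(ln (real y + 1) / 3)\<^sup>2 \<le> (\<Sum>A\<in>sieve_support y. 1 / real (\<Prod>A))\<^sup>2"
    using sum_sieve_support_inverse_ge[of y] L by (intro power_mono) auto
  also have "\<dots> \<le> V * h" unfolding V_def h_def by (rule pair_sieve_sum_ge) fact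
  finally have Vh: "(ln (real y + 1))\<^sup>2 \<le> 9 * V * h" by (simp add: power_divide)
  have "0 < V * h" using Vh L zero_less_power[OF L, of 2] by linarith
  hence V: "V > 0" using h by (simp add: zero_less_mult_iff)
  have NV: "real N / V \<le> 9 * real N * h / (ln (real y + 1))\<^sup>2"
    using mult_left_mono[OF Vh, of "real N"] V L by (simp add: field_simps)
  have "{n\<in>{1..N}. prime n \<and> prime (n + k)} \<subseteq> {1..y\<^sup>2} \<union> T"
  proof
    fix n assume n: "n \<in> {n\<in>{1..N}. prime n \<and> prime (n + k)}"
    have "\<not> p dvd n * (n + k)" if "n > y\<^sup>2" "p \<in> odd_primes_upto (y\<^sup>2)" for p
    proof
      have p: "prime p" "p \<le> y\<^sup>2" using that by (auto simp: odd_primes_upto_def)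
      assume "p dvd n * (n + k)"
      hence "p dvd n \<or> p dvd n + k" using p(1) prime_dvd_mult_iff by blast
      hence "p = n \<or> p = n + k" using n p(1) primes_dvd_imp_eq by blast
      thus False using that p by linarith
    qed
    thus "n \<in> {1..y\<^sup>2} \<union> T" using n by (auto simp: T_def)
  qed
  hence "card {n\<in>{1..N}. prime n \<and> prime (n + k)} \<le> card ({1..y\<^sup>2} \<union> T)"
    by (intro card_mono) (auto simp: T_def)
  also have "\<dots> \<le> y\<^sup>2 + card T" using card_Un_le[of "{1..y\<^sup>2}" T] by simp
  finally have "real (card {n\<in>{1..N}. prime n \<and> prime (n + k)}) \<le> real y ^ 2 + real (card T)"
    by (metis of_nat_add of_nat_le_iff of_nat_power)
  also have "real (card T) \<le> real N / V + real (y\<^sup>2) ^ 6"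
    unfolding T_def V_def using assms by (intro pair_sieve) auto
  also have "real (y\<^sup>2) ^ 6 = real y ^ 12" by (simp flip: power_mult)
  also have "real y ^ 2 \<le> real y ^ 12" using assms by (intro power_increasing) auto
  finally show ?thesis using NV by (simp add: h_def)
qed

text \<open>Cauchy-Schwarz for the number of representations \<open>n = p + b\<close>. Its second
  moment counts common elements of the translates \<open>P + b\<close> and \<open>P + b'\<close>:
  \<open>card P\<close> on the diagonal, and otherwise elements of \<open>P\<close> that stay in
  \<open>P\<close> after adding the difference.\<close>

lemma card_sumset_ge:
  fixes P B :: "nat set"
  assumes "finite P" "finite B"
    and T: "\<And>b b'. b \<in> B \<Longrightarrow> b' \<in> B \<Longrightarrow> b < b' \<Longrightarrow> real (card {p\<in>P. p + (b' - b) \<in> P}) \<le> T"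
    and "T \<ge> 0"
  shows "(real (card P) * real (card B))\<^sup>2 \<le>
    (real (card B) * real (card P) + (real (card B))\<^sup>2 * T) * real (card ((\<lambda>(p, b). p + b) ` (P \<times> B)))"
proof -
  define S where "S = (\<lambda>(p, b). p + b) ` (P \<times> B)"
  define C where "C = (\<lambda>b. (\<lambda>p. p + b) ` P)"
  define i where "i = (\<lambda>b n. if n \<in> C b then 1 else 0 :: real)"
  have finS [simp]: "finite S" using assms by (simp add: S_def)
  have CS: "C b \<subseteq> S" if "b \<in> B" for b using that by (auto simp: S_def C_def)
  have ii: "(\<Sum>n\<in>S. i b n * i b' n) = real (card (C b \<inter> C b'))" if "b \<in> B" for b b'
  proof -
    have "(\<Sum>n\<in>S. i b n * i b' n) = (\<Sum>n\<in>C b \<inter> C b'. 1)"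
      using CS[OF that] by (intro sum.mono_neutral_cong_right) (auto simp: i_def)
    thus ?thesis by simp
  qed
  have cardC: "card (C b) = card P" for b unfolding C_def by (rule card_image) simp
  have inter: "real (card (C b \<inter> C b')) \<le> T" if "b \<in> B" "b' \<in> B" "b < b'" for b b'
  proof -
    have "C b \<inter> C b' \<subseteq> (\<lambda>p. p + b') ` {p\<in>P. p + (b' - b) \<in> P}"
    proof
      fix n assume "n \<in> C b \<inter> C b'"
      then obtain p q where pq: "p \<in> P" "q \<in> P" "n = p + b" "n = q + b'" by (auto simp: C_def)
      hence "q + (b' - b) = p" using that by linarith
      thus "n \<in> (\<lambda>p. p + b') ` {p\<in>P. p + (b' - b) \<in> P}" using pq by blast
    qed
    hence "card (C b \<inter> C b') \<le> card {p\<in>P. p + (b' - b) \<in> P}"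
      using assms(1) by (intro surj_card_le) auto
    thus ?thesis using T[OF that] by linarith
  qed
  have "real (card P) * real (card B) = (\<Sum>n\<in>S. \<Sum>b\<in>B. i b n)"
  proof -
    have "(\<Sum>n\<in>S. \<Sum>b\<in>B. i b n) = (\<Sum>b\<in>B. \<Sum>n\<in>S. i b n * i b n)"
      by (subst sum.swap) (auto simp: i_def intro!: sum.cong)
    also have "\<dots> = (\<Sum>b\<in>B. real (card P))" by (intro sum.cong refl) (simp add: ii cardC)
    finally show ?thesis by simp
  qed
  hence "(real (card P) * real (card B))\<^sup>2 \<le> (\<Sum>n\<in>S. (\<Sum>b\<in>B. i b n)\<^sup>2) * real (card S)"
    using sum_squared_le_sum_of_squares[of "\<lambda>n. \<Sum>b\<in>B. i b n" S] by simp
  also have "(\<Sum>n\<in>S. (\<Sum>b\<in>B. i b n)\<^sup>2) = (\<Sum>b\<in>B. \<Sum>b'\<in>B. \<Sum>n\<in>S. i b n * i b' n)"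
    unfolding power2_eq_square sum_product by (subst sum.swap, intro sum.cong refl sum.swap)
  also have "\<dots> \<le> (\<Sum>b\<in>B. \<Sum>b'\<in>B. (if b' = b then real (card P) else 0) + T)"
  proof (intro sum_mono)
    fix b b' assume b: "b \<in> B" "b' \<in> B"
    show "(\<Sum>n\<in>S. i b n * i b' n) \<le> (if b' = b then real (card P) else 0) + T"
      using inter[of b b'] inter[of b' b] b \<open>T \<ge> 0\<close>
      by (cases b b' rule: linorder_cases) (auto simp: ii cardC Int_commute)
  qed
  also have "\<dots> = real (card B) * real (card P) + (real (card B))\<^sup>2 * T"
    using assms(2) by (simp add: sum.distrib power2_eq_square algebra_simps)
  finally show ?thesis by (simp add: S_def mult_right_mono)
qed

section \<open>Estimates for large \<open>x\<close>\<close>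

lemma half_le_ln_2: "1 / 2 \<le> ln (2::real)"
  using ln_le_minus_one[of "1 / 2"] by (simp add: ln_div)

text \<open>The cutoff is even, as the binomial argument requires, and at most \<open>x / 2\<close>,
  leaving room for \<open>b\<close>. Using \<open>1 / 2\<close> for \<open>ln 2\<close> gives about
  \<open>x / (4 * ln x)\<close>; halving this absorbs rounding.\<close>

lemma eventually_card_primes_ge:
  "\<forall>\<^sub>F x in at_top. x / (8 * ln x) \<le> real (card {p. prime p \<and> p \<le> 2 * nat \<lfloor>x / 4\<rfloor>})"
proof -
  have "\<forall>\<^sub>F x::real in at_top. x / (8 * ln x) \<le> ((x / 2 - 2) * (1 / 2)) / ln x - 1" by real_asymp
  moreover have "\<forall>\<^sub>F x::real in at_top. x \<ge> 10" by real_asymp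
  ultimately show ?thesis
  proof eventually_elim
    case (elim x)
    define n where "n = nat \<lfloor>x / 4\<rfloor>"
    have n: "n > 0" "real n \<le> x / 4" "real n \<ge> x / 4 - 1" using elim(2) unfolding n_def by linarith+
    have L: "ln (2 * real n) > 0" "ln (2 * real n) \<le> ln x" using n elim(2) by (auto simp: ln_le_cancel_iff)
    define c where "c = real (card {p. prime p \<and> p \<le> 2 * n})"
    have "2 * real n * ln 2 - ln (2 * real n) \<le> c * ln (2 * real n)"
      unfolding c_def by (rule chebyshev_lower_bound) fact
    hence "(2 * real n * ln 2) / ln (2 * real n) - 1 \<le> c" using L by (simp add: field_simps)
    moreover have "((x / 2 - 2) * (1 / 2)) / ln x \<le> (2 * real n * ln 2) / ln (2 * real n)"
      using n L elim(2) half_le_ln_2 by (intro frac_le mult_mono mult_nonneg_nonneg) auto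
    ultimately show ?case using elim(1) by (simp add: c_def n_def)
  qed
qed

text \<open>The threshold for \<open>x\<close> is uniform in \<open>N\<close> and \<open>k\<close>,
  which is needed because the differences range over a set growing with \<open>x\<close>. The
  constant is \<open>20736 = 9 * 4 * 24^2\<close>, and the additional 1 covers
  \<open>2 * y^12\<close>.\<close>

lemma eventually_prime_pairs_le:
  fixes E :: real
  assumes "E > 0"
  shows "\<forall>\<^sub>F x in at_top. \<forall>N k. real N \<le> x \<longrightarrow> 0 < k \<longrightarrow> real k \<le> ln x powr E \<longrightarrow>
    real (card {n\<in>{1..N}. prime n \<and> prime (n + k)}) \<le> (20736 * exp 3 + 1) * (x * ln (ln (ln x)) / (ln x)\<^sup>2)"
proof -
  have "\<forall>\<^sub>F x::real in at_top. 2 * E * ln (ln x) \<ge> 3" using assms by real_asymp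
  moreover have "\<forall>\<^sub>F x::real in at_top. ln (2 * E * ln (ln x) + 1) \<le> 2 * ln (ln (ln x))"
    using assms by real_asymp
  moreover have "\<forall>\<^sub>F x::real in at_top. 2 * x powr (1 / 2) \<le> x * ln (ln (ln x)) / (ln x)\<^sup>2" by real_asymp
  moreover have "\<forall>\<^sub>F x::real in at_top. x \<ge> exp 1" by real_asymp
  ultimately show ?thesis
  proof eventually_elim
    case (elim x)
    show ?case
    proof (intro allI impI)
      fix N k :: nat assume N: "real N \<le> x" and k: "0 < k" "real k \<le> ln x powr E"
      define lll where "lll = ln (ln (ln x))"
      \<comment> \<open>The exponent makes \<open>y^12\<close> at most the square root of
        \<open>x\<close>.\<close>
      define y where "y = nat \<lfloor>x powr (1 / 24)\<rfloor>"
      \<comment> \<open>Chosen so that \<open>2 ^ w\<close> exceeds \<open>(ln x) powr E\<close>, by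
        \<open>2 * ln 2 \<ge> 1\<close>; then \<open>ln w\<close> is of order
        \<open>ln (ln (ln x))\<close>.\<close>
      define w where "w = nat \<lceil>2 * E * ln (ln x)\<rceil>"
      define h where "h = (\<Prod>p\<in>prime_factors k. 1 + 1 / real p)"
      have x: "x \<ge> 1" "ln x \<ge> 1"
        using elim(4) exp_ge_add_one_self[of 1] ln_ge_iff[of x 1] by linarith+
      have w: "w \<ge> 3" "real w \<ge> 2 * E * ln (ln x)" "real w \<le> 2 * E * ln (ln x) + 1"
        unfolding w_def using elim(1) by linarith+
      have "ln (real w) \<le> ln (2 * E * ln (ln x) + 1)" using w elim(1) by (subst ln_le_cancel_iff) auto
      hence lnw: "ln (real w) \<le> 2 * lll" using elim(2) by (simp add: lll_def)
      have "real k \<le> exp (E * ln (ln x))" using k x by (auto simp: powr_def split: if_splits)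
      also have "\<dots> \<le> exp (real w * ln 2)"
      proof -
        have "E * ln (ln x) \<le> E * ln (ln x) * (2 * ln 2)"
          using half_le_ln_2 elim(1) mult_left_mono[of 1 "2 * ln 2" "E * ln (ln x)"] by simp
        also have "\<dots> = 2 * E * ln (ln x) * ln 2" by simp
        also have "\<dots> \<le> real w * ln 2" using w by (intro mult_right_mono) auto
        finally show ?thesis by simp
      qed
      also have "\<dots> = real (2 ^ w)" by (simp add: exp_of_nat_mult)
      finally have "k \<le> 2 ^ w" by (simp only: of_nat_le_iff)
      hence "h \<le> 2 * exp 3 * ln (real w)"
        unfolding h_def using w(1) k(1) by (intro prod_prime_factors_one_plus_inverse_le)
      also have "\<dots> \<le> 2 * exp 3 * (2 * lll)" using lnw by (intro mult_left_mono) auto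
      finally have h: "h \<le> 4 * exp 3 * lll" by simp
      have h0: "h \<ge> 0" unfolding h_def by (intro prod_nonneg) auto
      hence "0 \<le> 4 * exp 3 * lll" using h by linarith
      hence lll0: "lll \<ge> 0" by (simp add: zero_le_mult_iff)
      have "x powr (1 / 24) \<ge> 1" using x by (simp add: ge_one_powr_ge_zero)
      hence y: "y > 0" "real y \<le> x powr (1 / 24)" "x powr (1 / 24) \<le> real y + 1"
        unfolding y_def by linarith+
      have "real y ^ 12 \<le> (x powr (1 / 24)) ^ 12" using y by (intro power_mono) auto
      also have "\<dots> = x powr (1 / 2)" using x by (simp add: powr_power)
      finally have y12: "2 * real y ^ 12 \<le> x * lll / (ln x)\<^sup>2" using elim(3) by (simp add: lll_def)
      have "ln (x powr (1 / 24)) \<le> ln (real y + 1)" using y x by (subst ln_le_cancel_iff) auto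
      hence lny: "ln x / 24 \<le> ln (real y + 1)" using x by (simp add: ln_powr)
      have "real (card {n\<in>{1..N}. prime n \<and> prime (n + k)}) \<le>
        9 * real N * h / (ln (real y + 1))\<^sup>2 + 2 * real y ^ 12"
        unfolding h_def using y(1) k(1) by (rule prime_pair_count)
      also have "9 * real N * h / (ln (real y + 1))\<^sup>2 \<le> 9 * x * (4 * exp 3 * lll) / (ln x / 24)\<^sup>2"
        using N h h0 lll0 lny x by (intro frac_le mult_mono power_mono mult_nonneg_nonneg) auto
      also have "\<dots> = 20736 * exp 3 * (x * lll / (ln x)\<^sup>2)" by (simp add: power_divide)
      finally show "real (card {n\<in>{1..N}. prime n \<and> prime (n + k)}) \<le>
          (20736 * exp 3 + 1) * (x * ln (ln (ln x)) / (ln x)\<^sup>2)"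
        using y12 by (simp add: lll_def algebra_simps)
    qed
  qed
qed

theorem theorem1:
  fixes \<alpha> :: real and B :: "nat set"
  assumes "\<alpha> > 0"
    and "B \<subseteq> {1..}"
    and "c_condition B"
    and "\<exists>C::real. C > 0 \<and> (\<forall>\<^sub>F x::real in at_top. real (counting B x) \<ge> C * x powr \<alpha>)"
  shows "\<exists>C'::real. C' > 0 \<and>
           (\<forall>\<^sub>F x::real in at_top. real (counting (prime_plus B) x) \<ge> C' * (x / ln (ln (ln x))))"
proof -
  obtain C where C: "C > 0" "\<forall>\<^sub>F x::real in at_top. real (counting B x) \<ge> C * x powr \<alpha>"
    using assms(4) by blast
  define E where "E = 3 / \<alpha>"
  \<comment> \<open>The pair constant, plus 1 for the diagonal term.\<close>
  define K where "K = 20736 * exp 3 + 1 + (1::real)"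
  have E: "E > 0" using assms(1) by (simp add: E_def)
  have K: "K > 0" by (simp add: K_def add_pos_pos)
  have "filterlim (\<lambda>x::real. ln x powr E) at_top at_top" using E by real_asymp
  from eventually_compose_filterlim[OF C(2) this]
  have B1: "\<forall>\<^sub>F x in at_top. C * (ln x powr E) powr \<alpha> \<le> real (counting B (ln x powr E))" .
  have B2: "\<forall>\<^sub>F x::real in at_top. (ln x)\<^sup>2 \<le> C * ln x powr 3" using C(1) by real_asymp
  have B3: "\<forall>\<^sub>F x::real in at_top. ln x powr E \<le> x / 2" using E by real_asymp
  have "\<forall>\<^sub>F x::real in at_top. 1 \<le> ln (ln (ln x))" "\<forall>\<^sub>F x::real in at_top. x \<ge> 10"
    "\<forall>\<^sub>F x::real in at_top. ln x \<ge> 1" by real_asymp+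
  hence B4: "\<forall>\<^sub>F x::real in at_top. 1 \<le> ln (ln (ln x)) \<and> x \<ge> 10 \<and> ln x \<ge> 1"
    by eventually_elim auto
  \<comment> \<open>The 64 is the square of the 8 in the lower bound for the number of
    primes.\<close>
  have "\<forall>\<^sub>F x in at_top. real (counting (prime_plus B) x) \<ge> 1 / (64 * K) * (x / ln (ln (ln x)))"
    using B1 B2 B3 B4 eventually_card_primes_ge eventually_prime_pairs_le[OF E]
  proof eventually_elim
    case (elim x)
    define l where "l = ln x"
    define lll where "lll = ln (ln (ln x))"
    define N where "N = 2 * nat \<lfloor>x / 4\<rfloor>"
    define P where "P = {p. prime p \<and> p \<le> N}"
    define D where "D = {b\<in>B. 1 \<le> b \<and> real b \<le> l powr E}"
    define T where "T = (20736 * exp 3 + 1) * (x * lll / l\<^sup>2)"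
    define M where "M = real (counting (prime_plus B) x)"
    define d where "d = real (card D)"
    have x: "x \<ge> 10" "l \<ge> 1" "lll \<ge> 1" using elim(4) by (auto simp: l_def lll_def)
    have N: "real N \<le> x / 2" using x unfolding N_def by linarith
    have finP: "finite P" unfolding P_def by (rule finite_subset[of _ "{..N}"]) auto
    have finD: "finite D" unfolding D_def
      by (rule finite_subset[of _ "{..nat \<lfloor>l powr E\<rfloor>}"]) (auto simp: le_nat_floor)
    have T0: "T \<ge> 0" using x by (simp add: T_def)
    have cardP: "x / (8 * l) \<le> real (card P)" using elim(5) by (simp add: l_def P_def N_def)
    have "card P \<le> card {1..N}"
      by (rule card_mono) (auto simp: P_def Suc_le_eq prime_gt_0_nat)
    hence cardP': "real (card P) \<le> x" using N x by simp
    have "l\<^sup>2 \<le> C * (l powr E) powr \<alpha>"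
      using elim(2) assms(1) by (simp add: powr_powr E_def l_def)
    also have "\<dots> \<le> d" using elim(1) by (simp add: d_def D_def l_def counting_def)
    finally have d: "l\<^sup>2 \<le> d" .
    hence dpos: "d > 0" using x zero_less_power[of l 2] by linarith
    have pairs: "real (card {p\<in>P. p + (b' - b) \<in> P}) \<le> T" if "b \<in> D" "b' \<in> D" "b < b'" for b b'
    proof -
      have "card {p\<in>P. p + (b' - b) \<in> P} \<le> card {n\<in>{1..N}. prime n \<and> prime (n + (b' - b))}"
        by (intro card_mono) (auto simp: P_def Suc_le_eq prime_gt_0_nat)
      moreover have "real (b' - b) \<le> ln x powr E" using that by (auto simp: D_def l_def)
      moreover have "real N \<le> x" using N x by linarith
      moreover have "0 < b' - b" using that by simp
      ultimately show ?thesis using elim(6)[rule_format, of N "b' - b"]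
        unfolding T_def l_def lll_def by linarith
    qed
    have sumset: "(\<lambda>(p, b). p + b) ` (P \<times> D) \<subseteq> {n\<in>prime_plus B. 1 \<le> n \<and> real n \<le> x}"
    proof safe
      fix p b assume p: "p \<in> P" and b: "b \<in> D"
      show "p + b \<in> prime_plus B" using p b by (auto simp: P_def D_def prime_plus_def)
      show "1 \<le> p + b" using b by (auto simp: D_def)
      have "real p \<le> x / 2" using p N by (auto simp: P_def)
      moreover have "real b \<le> x / 2" using b elim(3) by (auto simp: D_def l_def)
      ultimately show "real (p + b) \<le> x" by simp
    qed
    have "finite {n\<in>prime_plus B. 1 \<le> n \<and> real n \<le> x}"
      by (rule finite_subset[of _ "{..nat \<lfloor>x\<rfloor>}"]) (auto simp: le_nat_floor)
    from card_mono[OF this sumset]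
    have cardM: "real (card ((\<lambda>(p, b). p + b) ` (P \<times> D))) \<le> M"
      by (simp add: M_def counting_def)
    have "(x / (8 * l) * d)\<^sup>2 \<le> (real (card P) * d)\<^sup>2"
      using cardP x by (intro power_mono mult_right_mono) (auto simp: d_def)
    also have "\<dots> \<le> (d * real (card P) + d\<^sup>2 * T) * real (card ((\<lambda>(p, b). p + b) ` (P \<times> D)))"
      unfolding d_def by (intro card_sumset_ge finP finD pairs T0)
    also have "\<dots> \<le> (d\<^sup>2 * (K * (x * lll / l\<^sup>2))) * M"
    proof (rule mult_mono)
      \<comment> \<open>Because \<open>d\<close> is at least \<open>l^2\<close>, even the trivial
        bound \<open>x\<close> for \<open>card P\<close> puts the diagonal below the off-diagonal
        bound.\<close>
      have "d * real (card P) \<le> d * x" using cardP' dpos by simp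
      also have "\<dots> \<le> d\<^sup>2 * (x / l\<^sup>2)"
      proof -
        have "d * x * l\<^sup>2 \<le> d * x * d" using d dpos x by (intro mult_left_mono) auto
        thus ?thesis using x by (simp add: field_simps power2_eq_square)
      qed
      also have "\<dots> \<le> d\<^sup>2 * (x * lll / l\<^sup>2)"
        using x by (intro mult_left_mono divide_right_mono) auto
      finally have "d * real (card P) \<le> d\<^sup>2 * (x * lll / l\<^sup>2)" .
      moreover have "K * (x * lll / l\<^sup>2) = T + x * lll / l\<^sup>2"
        unfolding K_def T_def by (simp only: distrib_right mult_1)
      hence "d\<^sup>2 * (K * (x * lll / l\<^sup>2)) = d\<^sup>2 * T + d\<^sup>2 * (x * lll / l\<^sup>2)"
        by (simp only: distrib_left)
      ultimately show "d * real (card P) + d\<^sup>2 * T \<le> d\<^sup>2 * (K * (x * lll / l\<^sup>2))"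
        by linarith
    qed (use cardM K x in auto)
    finally have "x / (64 * K * lll) \<le> M"
      using dpos x K by (simp add: field_simps power2_eq_square)
    thus ?case by (simp add: M_def lll_def)
  qed
  thus ?thesis using K by (intro exI[of _ "1 / (64 * K)"]) simp
qed

end
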